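(* Let $\mathcal{T}=(V,E)$ be a directed tree and $S_{\boldsymbol{\lambda}}$ a contractive weighted shift on $\mathcal{T}$. (i) If $\mathcal{T}$ has a root and $S_{\boldsymbol{\lambda}}$ is of class $C_{1\cdot}$, then $S_{\boldsymbol{\lambda}}^*$ is cyclic. (ii) If $\mathcal{T}$ is rootless, $\mathrm{Br}(\mathcal{T})<\infty$ and $S_{\boldsymbol{\lambda}}$ is of class $C_{1\cdot}$, then $S_{\boldsymbol{\lambda}}^*$ is cyclic.
   Context: A directed tree $\mathcal{T}=(V,E)$ consists of a non-empty vertex set $V$ and an edge set $E\subseteq V\times V\setminus\{(v,v)\colon v\in V\}$ such that there are no directed circuits, the underlying undirected graph is connected, and each vertex $v$ has at most one parent, i.e. at most one $u$ with $(u,v)\in E$. A vertex without a parent is a root; there is at most one. $V^\circ$ is $V$ minus the root if a root exists, and $V^\circ=V$ otherwise. $\mathrm{Chi}(u)=\{v\colon(u,v)\in E\}$. The branching index is $\mathrm{Br}(\mathcal{T})=\sum_{u\colon|\mathrm{Chi}(u)|>1}(|\mathrm{Chi}(u)|-1)\in\mathbb{N}_0\cup\{\infty\}$. $\ell^2(V)$ is the complex Hilbert space of square-summable functions on $V$ with orthonormal basis $\{e_u\}_{u\in V}$. Given weights $\boldsymbol{\lambda}=\{\lambda_v\colon v\in V^\circ\}\subseteq(0,\infty)$ with $\sup_{u\in V}\sum_{v\in\mathrm{Chi}(u)}\lambda_v^2<\infty$, the weighted shift $S_{\boldsymbol{\lambda}}$ on $\mathcal{T}$ is the bounded operator on $\ell^2(V)$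 with $S_{\boldsymbol{\lambda}}e_u=\sum_{v\in\mathrm{Chi}(u)}\lambda_ve_v$ (all weights are assumed positive). It is contractive if $\|S_{\boldsymbol{\lambda}}\|\le1$. A contraction $T\in\mathcal{B}(\mathcal{H})$ is of class $C_{1\cdot}$ if $h=0$ is the only vector with $\lim_n\|T^nh\|=0$. An operator $T\in\mathcal{B}(\mathcal{H})$ is cyclic if there is $h\in\mathcal{H}$ such that the closed linear span of $\{T^nh\colon n\ge0\}$ is $\mathcal{H}$. *)

theory Defs
  imports "HOL-Analysis.Analysis"
begin

section \<open>The complex Hilbert space of square-summable functions\<close>

definition square_summable :: "('v \<Rightarrow> complex) \<Rightarrow> bool" where
  "square_summable f \<longleftrightarrow> (\<lambda>v. (cmod (f v))\<^sup>2) summable_on UNIV"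

lemma square_summable_zero: "square_summable (\<lambda>v. 0)"
  by (simp add: square_summable_def)

lemma square_summable_add:
  assumes "square_summable f" "square_summable g"
  shows "square_summable (\<lambda>v. f v + g v)"
  unfolding square_summable_def
proof (rule summable_on_comparison_test)
  show "(\<lambda>v. 2 * (cmod (f v))\<^sup>2 + 2 * (cmod (g v))\<^sup>2) summable_on UNIV"
    using assms unfolding square_summable_def
    by (intro summable_on_add summable_on_cmult_right)
  fix v :: 'a
  have "(cmod (f v + g v))\<^sup>2 \<le> (cmod (f v) + cmod (g v))\<^sup>2"
    by (simp add: norm_triangle_ineq)
  also have "\<dots> \<le> 2 * (cmod (f v))\<^sup>2 + 2 * (cmod (g v))\<^sup>2"
    using sum_squares_bound[of "cmod (f v)" "cmod (g v)"] by (simp add: power2_sum)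
  finally show "(cmod (f v + g v))\<^sup>2 \<le> 2 * (cmod (f v))\<^sup>2 + 2 * (cmod (g v))\<^sup>2" .
qed auto

lemma square_summable_scale:
  assumes "square_summable f"
  shows "square_summable (\<lambda>v. c * f v)"
  using assms unfolding square_summable_def norm_mult power_mult_distrib
  by (rule summable_on_cmult_right)

lemma square_summable_finite_support:
  assumes "finite {v. f v \<noteq> 0}"
  shows "square_summable f"
proof -
  have "(\<lambda>v. (cmod (f v))\<^sup>2) summable_on {v. f v \<noteq> 0}"
    using assms by simp
  then show ?thesis
    unfolding square_summable_def
    by (rule summable_on_cong_neutral[THEN iffD1, rotated -1]) auto
qed

typedef 'v ell2 = "{f :: 'v \<Rightarrow> complex. square_summable f}"
  morphisms coord Abs_ell2
  using square_summable_zero by blast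

setup_lifting type_definition_ell2

lemma square_summable_coord: "square_summable (coord x)"
  using coord by auto

lemma ell2_eqI: "(\<And>v. coord x v = coord y v) \<Longrightarrow> x = y"
  by (simp add: coord_inject[symmetric] fun_eq_iff)

lift_definition basis_vec :: "'v \<Rightarrow> 'v ell2" is "\<lambda>u v. if v = u then 1 else 0"
  by (rule square_summable_finite_support) auto

lift_definition scaleC :: "complex \<Rightarrow> 'v ell2 \<Rightarrow> 'v ell2" (infixr "*\<^sub>C" 75)
  is "\<lambda>c f v. c * f v"
  by (rule square_summable_scale)

definition cinner :: "'v ell2 \<Rightarrow> 'v ell2 \<Rightarrow> complex" where
  "cinner x y = (\<Sum>\<^sub>\<infinity>v. coord x v * cnj (coord y v))"

lemma summable_cinner: "(\<lambda>v. coord x v * cnj (coord y v)) summable_on UNIV"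
proof -
  have "(\<lambda>v. norm (coord x v * cnj (coord y v))) summable_on UNIV"
  proof (rule summable_on_comparison_test)
    show "(\<lambda>v. (cmod (coord x v))\<^sup>2 + (cmod (coord y v))\<^sup>2) summable_on UNIV"
      using square_summable_coord[of x] square_summable_coord[of y]
      unfolding square_summable_def by (rule summable_on_add)
    fix v
    have "0 \<le> cmod (coord x v) * cmod (coord y v)" by (rule mult_nonneg_nonneg) auto
    then show "norm (coord x v * cnj (coord y v)) \<le> (cmod (coord x v))\<^sup>2 + (cmod (coord y v))\<^sup>2"
      using sum_squares_bound[of "cmod (coord x v)" "cmod (coord y v)"]
      by (simp only: norm_mult complex_mod_cnj)
  qed auto
  then show ?thesis by (rule abs_summable_summable)
qed

instantiation ell2 :: (type) real_inner
begin

lift_definition zero_ell2 :: "'a ell2" is "\<lambda>v. 0"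
  by (rule square_summable_zero)

lift_definition plus_ell2 :: "'a ell2 \<Rightarrow> 'a ell2 \<Rightarrow> 'a ell2" is "\<lambda>f g v. f v + g v"
  by (rule square_summable_add)

lift_definition uminus_ell2 :: "'a ell2 \<Rightarrow> 'a ell2" is "\<lambda>f v. - f v"
  by (simp add: square_summable_def)

definition minus_ell2 :: "'a ell2 \<Rightarrow> 'a ell2 \<Rightarrow> 'a ell2" where
  "minus_ell2 x y = x + - y"

definition scaleR_ell2 :: "real \<Rightarrow> 'a ell2 \<Rightarrow> 'a ell2" where
  "scaleR_ell2 r x = complex_of_real r *\<^sub>C x"

definition inner_ell2 :: "'a ell2 \<Rightarrow> 'a ell2 \<Rightarrow> real" where
  "inner_ell2 x y = Re (cinner x y)"

definition norm_ell2 :: "'a ell2 \<Rightarrow> real" where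
  "norm_ell2 x = sqrt (\<Sum>\<^sub>\<infinity>v. (cmod (coord x v))\<^sup>2)"

definition sgn_ell2 :: "'a ell2 \<Rightarrow> 'a ell2" where
  "sgn_ell2 x = inverse (norm x) *\<^sub>R x"

definition dist_ell2 :: "'a ell2 \<Rightarrow> 'a ell2 \<Rightarrow> real" where
  "dist_ell2 x y = norm (x - y)"

definition uniformity_ell2 :: "('a ell2 \<times> 'a ell2) filter" where
  "uniformity_ell2 = (INF e\<in>{0<..}. principal {(x, y). dist x y < e})"

definition open_ell2 :: "'a ell2 set \<Rightarrow> bool" where
  "open_ell2 U \<longleftrightarrow> (\<forall>x\<in>U. \<forall>\<^sub>F (x', y) in uniformity. x' = x \<longrightarrow> y \<in> U)"

instance
proof
  fix x y z :: "'a ell2" and r s :: real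
  show "x + y + z = x + (y + z)" by transfer (simp add: add.assoc)
  show "x + y = y + x" by transfer (simp add: add.commute)
  show "0 + x = x" by transfer simp
  show "- x + x = 0" by transfer simp
  show "x - y = x + - y" by (rule minus_ell2_def)
  show "r *\<^sub>R (x + y) = r *\<^sub>R x + r *\<^sub>R y"
    unfolding scaleR_ell2_def by transfer (simp add: algebra_simps)
  show "(r + s) *\<^sub>R x = r *\<^sub>R x + s *\<^sub>R x"
    unfolding scaleR_ell2_def by transfer (simp add: algebra_simps)
  show "r *\<^sub>R s *\<^sub>R x = (r * s) *\<^sub>R x"
    unfolding scaleR_ell2_def by transfer (simp add: algebra_simps)
  show "1 *\<^sub>R x = x"
    unfolding scaleR_ell2_def by transfer simp
  show "dist x y = norm (x - y)" by (rule dist_ell2_def)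
  show "sgn x = inverse (norm x) *\<^sub>R x" by (rule sgn_ell2_def)
  show "uniformity = (INF e\<in>{0<..}. principal {(x, y :: 'a ell2). dist x y < e})"
    by (rule uniformity_ell2_def)
  show "open U \<longleftrightarrow> (\<forall>x\<in>U. \<forall>\<^sub>F (x', y) in uniformity. x' = x \<longrightarrow> y \<in> U)"
    for U :: "'a ell2 set"
    by (rule open_ell2_def)
  show "x \<bullet> y = y \<bullet> x"
  proof -
    have "cinner x y = cnj (cinner y x)"
      unfolding cinner_def infsum_cnj[symmetric] by (simp add: mult.commute)
    then show ?thesis by (simp add: inner_ell2_def)
  qed
  show "(x + y) \<bullet> z = x \<bullet> z + y \<bullet> z"
    by (simp add: inner_ell2_def cinner_def plus_ell2.rep_eq ring_distribs
        infsum_add summable_cinner)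
  show "(r *\<^sub>R x) \<bullet> y = r * (x \<bullet> y)"
    by (simp add: inner_ell2_def cinner_def scaleR_ell2_def scaleC.rep_eq mult.assoc
        infsum_cmult_right summable_cinner)
  have sq: "(\<lambda>v. (cmod (coord x v))\<^sup>2) summable_on UNIV"
    using square_summable_coord[of x] by (simp add: square_summable_def)
  have xx: "x \<bullet> x = (\<Sum>\<^sub>\<infinity>v. (cmod (coord x v))\<^sup>2)"
  proof -
    have "cinner x x = (\<Sum>\<^sub>\<infinity>v. complex_of_real ((cmod (coord x v))\<^sup>2))"
      unfolding cinner_def complex_norm_square ..
    also have "\<dots> = complex_of_real (\<Sum>\<^sub>\<infinity>v. (cmod (coord x v))\<^sup>2)"
      by (intro infsumI has_sum_of_real has_sum_infsum sq)
    finally show ?thesis by (simp add: inner_ell2_def)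
  qed
  show "0 \<le> x \<bullet> x" unfolding xx by (rule infsum_nonneg) simp
  show "x \<bullet> x = 0 \<longleftrightarrow> x = 0"
  proof
    assume "x \<bullet> x = 0"
    then have "(cmod (coord x v))\<^sup>2 = 0" for v
      using nonneg_infsum_le_0D[OF _ sq, of v] by (simp add: xx)
    then show "x = 0" by (intro ell2_eqI) (simp add: zero_ell2.rep_eq)
  qed (simp add: inner_ell2_def cinner_def zero_ell2.rep_eq)
  show "norm x = sqrt (x \<bullet> x)" by (simp add: norm_ell2_def xx)
qed

end

lemma coord_add: "coord (x + y) v = coord x v + coord y v"
  by (simp add: plus_ell2.rep_eq)

lemma coord_diff: "coord (x - y) v = coord x v - coord y v"
  unfolding minus_ell2_def plus_ell2.rep_eq uminus_ell2.rep_eq by simp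

lemma norm_ell2_squared: "(norm x)\<^sup>2 = (\<Sum>\<^sub>\<infinity>v. (cmod (coord x v))\<^sup>2)"
  by (simp add: norm_ell2_def infsum_nonneg)

lemma sum_coord_le_norm:
  assumes "finite F"
  shows "(\<Sum>v\<in>F. (cmod (coord x v))\<^sup>2) \<le> (norm x)\<^sup>2"
  unfolding norm_ell2_squared
  using square_summable_coord[of x] assms
  by (intro finite_sum_le_infsum) (auto simp: square_summable_def)

lemma cmod_coord_le_norm: "cmod (coord x v) \<le> norm x"
  using sum_coord_le_norm[of "{v}" x] by (auto intro: power2_le_imp_le)

instance ell2 :: (type) complete_space
proof
  fix X :: "nat \<Rightarrow> 'a ell2"
  assume X: "Cauchy X"
  have "Cauchy (\<lambda>n. coord (X n) v)" for v
  proof (rule metric_CauchyI)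
    fix e :: real assume "0 < e"
    then obtain M where M: "\<And>m n. m \<ge> M \<Longrightarrow> n \<ge> M \<Longrightarrow> dist (X m) (X n) < e"
      using metric_CauchyD[OF X] by blast
    have "dist (coord (X m) v) (coord (X n) v) \<le> dist (X m) (X n)" for m n
      using cmod_coord_le_norm[of "X m - X n" v] by (simp add: dist_norm coord_diff)
    then show "\<exists>M. \<forall>m\<ge>M. \<forall>n\<ge>M. dist (coord (X m) v) (coord (X n) v) < e"
      using M by (meson le_less_trans)
  qed
  then have "\<exists>l. (\<lambda>n. coord (X n) v) \<longlonglongrightarrow> l" for v
    by (simp add: Cauchy_convergent_iff convergent_def)
  then obtain l where l: "\<And>v. (\<lambda>n. coord (X n) v) \<longlonglongrightarrow> l v"
    by metis
  have tail: "(\<Sum>v\<in>F. (cmod (coord (X n) v - l v))\<^sup>2) \<le> e\<^sup>2"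
    if M: "\<And>m n. m \<ge> M \<Longrightarrow> n \<ge> M \<Longrightarrow> dist (X m) (X n) < e" and n: "n \<ge> M" and F: "finite F"
    for M n e F
  proof (rule tendsto_upperbound)
    show "(\<lambda>m. \<Sum>v\<in>F. (cmod (coord (X n) v - coord (X m) v))\<^sup>2)
        \<longlonglongrightarrow> (\<Sum>v\<in>F. (cmod (coord (X n) v - l v))\<^sup>2)"
      by (intro tendsto_intros l)
    show "\<forall>\<^sub>F m in sequentially. (\<Sum>v\<in>F. (cmod (coord (X n) v - coord (X m) v))\<^sup>2) \<le> e\<^sup>2"
      using eventually_ge_at_top[of M]
    proof eventually_elim
      case (elim m)
      have "(\<Sum>v\<in>F. (cmod (coord (X n - X m) v))\<^sup>2) \<le> (norm (X n - X m))\<^sup>2"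
        by (rule sum_coord_le_norm[OF F])
      also have "\<dots> \<le> e\<^sup>2"
        using M[OF n elim] by (intro power_mono) (auto simp: dist_norm)
      finally show ?case by (simp add: coord_diff)
    qed
  qed simp
  have diff: "square_summable (\<lambda>v. coord (X n) v - l v)"
    if "\<And>m n. m \<ge> M \<Longrightarrow> n \<ge> M \<Longrightarrow> dist (X m) (X n) < e" and "n \<ge> M" for M n e
    unfolding square_summable_def
    by (rule nonneg_bdd_above_summable_on) (use tail[OF that] in \<open>auto intro!: bdd_aboveI\<close>)
  obtain M1 where M1: "\<And>m n. m \<ge> M1 \<Longrightarrow> n \<ge> M1 \<Longrightarrow> dist (X m) (X n) < 1"
    using metric_CauchyD[OF X, of 1] by auto
  have "square_summable (\<lambda>v. coord (X M1) v + (- 1) * (coord (X M1) v - l v))"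
    by (intro square_summable_add square_summable_scale square_summable_coord diff[OF M1]) auto
  then have "square_summable l" by simp
  then have L: "coord (Abs_ell2 l) = l" by (simp add: Abs_ell2_inverse)
  have "X \<longlonglongrightarrow> Abs_ell2 l"
  proof (rule metric_LIMSEQ_I)
    fix e :: real assume e: "0 < e"
    then obtain M where M: "\<And>m n. m \<ge> M \<Longrightarrow> n \<ge> M \<Longrightarrow> dist (X m) (X n) < e / 2"
      using metric_CauchyD[OF X, of "e / 2"] by auto
    have "dist (X n) (Abs_ell2 l) < e" if n: "n \<ge> M" for n
    proof -
      have "(norm (X n - Abs_ell2 l))\<^sup>2 \<le> (e / 2)\<^sup>2"
        unfolding norm_ell2_squared coord_diff L
        using diff[OF M n] tail[OF M n]
        by (intro infsum_le_finite_sums) (auto simp: square_summable_def)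
      then have "norm (X n - Abs_ell2 l) \<le> e / 2"
        by (rule power2_le_imp_le) (use e in simp)
      then show ?thesis using e by (simp add: dist_norm)
    qed
    then show "\<exists>M. \<forall>n\<ge>M. dist (X n) (Abs_ell2 l) < e" by blast
  qed
  then show "convergent X" by (rule convergentI)
qed

interpretation ell2: vector_space "scaleC :: complex \<Rightarrow> 'v ell2 \<Rightarrow> 'v ell2"
  by unfold_locales (auto intro!: ell2_eqI simp: scaleC.rep_eq coord_add algebra_simps)


section \<open>Operators\<close>

abbreviation bounded_operator :: "('v ell2 \<Rightarrow> 'v ell2) \<Rightarrow> bool" where
  "bounded_operator T \<equiv> Vector_Spaces.linear scaleC scaleC T \<and> bounded_linear T"

text \<open>A bounded operator has exactly one map satisfying the defining identity of its adjoint.\<close>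

definition hadjoint :: "('v ell2 \<Rightarrow> 'v ell2) \<Rightarrow> 'v ell2 \<Rightarrow> 'v ell2" where
  "hadjoint T = (THE T'. \<forall>x y. cinner (T x) y = cinner x (T' y))"

definition contraction :: "('v ell2 \<Rightarrow> 'v ell2) \<Rightarrow> bool" where
  "contraction T \<longleftrightarrow> bounded_operator T \<and> onorm T \<le> 1"

definition class_C1 :: "('v ell2 \<Rightarrow> 'v ell2) \<Rightarrow> bool" where
  "class_C1 T \<longleftrightarrow> contraction T \<and> (\<forall>h. (\<lambda>n. norm ((T ^^ n) h)) \<longlonglongrightarrow> 0 \<longleftrightarrow> h = 0)"

definition cyclic :: "('v ell2 \<Rightarrow> 'v ell2) \<Rightarrow> bool" where
  "cyclic T \<longleftrightarrow> (\<exists>h. closure (ell2.span (range (\<lambda>n. (T ^^ n) h))) = UNIV)"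

lemma hadjoint_eqI:
  assumes "\<And>x y. cinner (T x) y = cinner x (T' y)"
  shows "hadjoint T = T'"
  unfolding hadjoint_def
proof (rule the_equality)
  fix T'' assume T'': "\<forall>x y. cinner (T x) y = cinner x (T'' y)"
  show "T'' = T'"
  proof
    fix y
    have "x \<bullet> T'' y = x \<bullet> T' y" for x
      using T'' assms by (simp add: inner_ell2_def)
    then show "T'' y = T' y" using vector_eq_ldot by blast
  qed
qed (use assms in blast)


section \<open>Directed trees and weighted shifts\<close>

text \<open>The vertex set is the whole type \<^typ>\<open>'v\<close>, which is non-empty like every type;
  acyclicity also excludes loops.\<close>

definition directed_tree :: "('v \<times> 'v) set \<Rightarrow> bool" where
  "directed_tree E \<longleftrightarrow>
     acyclic E \<and>
     (\<forall>u v. (u, v) \<in> (E \<union> E\<inverse>)\<^sup>*) \<and>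
     (\<forall>u u' v. (u, v) \<in> E \<longrightarrow> (u', v) \<in> E \<longrightarrow> u = u')"

definition is_root :: "('v \<times> 'v) set \<Rightarrow> 'v \<Rightarrow> bool" where
  "is_root E v \<longleftrightarrow> (\<nexists>u. (u, v) \<in> E)"

definition nonroots :: "('v \<times> 'v) set \<Rightarrow> 'v set" where
  "nonroots E = {v. \<not> is_root E v}"

definition Chi :: "('v \<times> 'v) set \<Rightarrow> 'v \<Rightarrow> 'v set" where
  "Chi E u = {v. (u, v) \<in> E}"

definition ecard :: "'a set \<Rightarrow> enat" where
  "ecard A = (if finite A then enat (card A) else \<infinity>)"

text \<open>Sums of non-negative terms in \<^typ>\<open>enat\<close> and \<^typ>\<open>ennreal\<close> always converge,
  so \<^const>\<open>infsum\<close> is the true, possibly infinite, sum.\<close>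

definition Br :: "('v \<times> 'v) set \<Rightarrow> enat" where
  "Br E = (\<Sum>\<^sub>\<infinity>u\<in>{u. 1 < ecard (Chi E u)}. ecard (Chi E u) - 1)"

text \<open>The value of a weight function at the root is irrelevant.\<close>

definition admissible_weights :: "('v \<times> 'v) set \<Rightarrow> ('v \<Rightarrow> real) \<Rightarrow> bool" where
  "admissible_weights E lam \<longleftrightarrow>
     (\<forall>v\<in>nonroots E. 0 < lam v) \<and>
     (SUP u. \<Sum>\<^sub>\<infinity>v\<in>Chi E u. ennreal ((lam v)\<^sup>2)) < \<infinity>"

definition weighted_shift ::
    "('v \<times> 'v) set \<Rightarrow> ('v \<Rightarrow> real) \<Rightarrow> ('v ell2 \<Rightarrow> 'v ell2) \<Rightarrow> bool" where
  "weighted_shift E lam S \<longleftrightarrow>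
     bounded_operator S \<and>
     (\<forall>u. ((\<lambda>v. lam v *\<^sub>R basis_vec v) has_sum S (basis_vec u)) (Chi E u))"

end

theory Submission
  imports Defs "HOL-Complex_Analysis.Cauchy_Integral_Formula"
begin

text \<open>Write \<open>T\<close> for the adjoint of the shift \<open>S\<close>. The strong limit \<open>A\<close> of \<open>T\<^sup>k S\<^sup>k\<close> satisfies
  \<open>T A S = A\<close> and, by \<open>C\<^sub>1\<close>, multiplies each basis vector by a non-zero scalar. Hence
  \<open>b\<^sub>n = A S\<^sup>n e\<^sub>w\<close> is a backward orbit of \<open>T\<close>, on which polynomials in \<open>T\<close> are dominated by
  polynomials in the bilateral shift. Any vertex \<open>v\<close> has a common ancestor with \<open>w\<close>, so a
  suitable power of \<open>T\<close> annihilates \<open>e\<^sub>v\<close> minus a multiple of some vector in this orbit: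
  the space is the closure of the sum of the kernels of all powers of \<open>T\<close> and of the span of the
  orbit. On the kernels \<open>T\<close> satisfies the supercyclicity criterion; on the orbit the
  cyclicity of the bilateral shift is used, in a quantitative form which comes from an analytic
  function that is small on most of the circle although it equals \<open>1\<close> at the origin. Both are
  combined in a Baire category argument.\<close>

section \<open>Polynomials on the unit circle\<close>

text \<open>\<open>degree (pCons a P)\<close> is \<open>Suc (degree P)\<close> only for non-zero
  \<open>P\<close>; for \<open>P = 0\<close> the surplus term on the right vanishes because
  \<open>f i 0 = 0\<close>.\<close>

lemma sum_coeff_pCons:
  fixes f :: "nat \<Rightarrow> 'a::comm_monoid_add \<Rightarrow> 'b::comm_monoid_add"
  assumes "\<And>i. f i 0 = 0"
  shows "(\<Sum>i\<le>degree (pCons a P). f i (coeff (pCons a P) i)) =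
         f 0 a + (\<Sum>i\<le>degree P. f (Suc i) (coeff P i))"
proof (cases "P = 0")
  case False
  then show ?thesis
    by (simp add: sum.atMost_Suc_shift del: sum.atMost_Suc)
qed (use assms in simp)

section \<open>Parseval's identity and trigonometric approximation on the circle\<close>

definition coeff_sqsum :: "complex poly \<Rightarrow> real" where
  "coeff_sqsum P = (\<Sum>i\<le>degree P. (cmod (coeff P i))\<^sup>2)"

lemma coeff_sqsum_pCons: "coeff_sqsum (pCons a P) = (cmod a)\<^sup>2 + coeff_sqsum P"
  unfolding coeff_sqsum_def by (subst sum_coeff_pCons) auto

lemma has_integral_cis_mult:
  assumes "n \<noteq> 0"
  shows "((\<lambda>t. cis (real n * t)) has_integral 0) {0..2 * pi}"
proof -
  have "((\<lambda>t. cis (real n * t)) has_integral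
      (cis (real n * (2 * pi)) / (\<i> * of_nat n) - cis (real n * 0) / (\<i> * of_nat n))) {0..2 * pi}"
  proof (rule fundamental_theorem_of_calculus)
    fix t :: real
    have "((\<lambda>t. cis (real n * t)) has_derivative (\<lambda>s. (real n * s) *\<^sub>R (\<i> * cis (real n * t))))
        (at t within {0..2 * pi})"
      by (intro has_derivative_cis has_derivative_mult_right has_derivative_ident)
    then have "((\<lambda>t. cis (real n * t)) has_vector_derivative (\<i> * of_nat n) * cis (real n * t))
        (at t within {0..2 * pi})"
      by (simp add: has_vector_derivative_def scaleR_conv_of_real mult_ac)
    from has_vector_derivative_divide[OF this, of "\<i> * of_nat n"]
    show "((\<lambda>t. cis (real n * t) / (\<i> * of_nat n)) has_vector_derivative cis (real n * t))
        (at t within {0..2 * pi})"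
      using assms by simp
  qed simp
  moreover have "cis (real n * (2 * pi)) = 1"
    using cis_multiple_2pi[of "real n"] by (simp add: mult_ac)
  ultimately show ?thesis by simp
qed

lemma integral_cis_mult_poly:
  "((\<lambda>t. cis t * poly P (cis t)) has_integral 0) {0..2 * pi}"
proof -
  have "((\<lambda>t. \<Sum>i\<le>degree P. coeff P i * cis (real (Suc i) * t)) has_integral
      (\<Sum>i\<le>degree P. coeff P i * 0)) {0..2 * pi}"
    by (intro has_integral_sum has_integral_mult_right has_integral_cis_mult) auto
  moreover have "(\<Sum>i\<le>degree P. coeff P i * cis (real (Suc i) * t)) = cis t * poly P (cis t)" for t
    by (simp add: poly_altdef sum_distrib_left Complex.DeMoivre ring_distribs mult_ac flip: cis_mult)
  ultimately show ?thesis by simp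
qed

text \<open>Induction over the coefficients: in \<open>|a + z P(z)|^2\<close> the cross term
  integrates to 0, since \<open>z P(z)\<close> has no constant term.\<close>

lemma parseval:
  "((\<lambda>t. (cmod (poly P (cis t)))\<^sup>2) has_integral (2 * pi * coeff_sqsum P)) {0..2 * pi}"
proof (induction P)
  case 0
  then show ?case by (simp add: coeff_sqsum_def)
next
  case (pCons a P)
  have "((\<lambda>t. Re (cnj a * (cis t * poly P (cis t)))) has_integral Re (cnj a * 0)) {0..2 * pi}"
    by (intro has_integral_Re has_integral_mult_right integral_cis_mult_poly)
  then have "((\<lambda>t. (cmod a)\<^sup>2 + (cmod (poly P (cis t)))\<^sup>2 + 2 * Re (cnj a * (cis t * poly P (cis t))))
      has_integral ((2 * pi - 0) *\<^sub>R (cmod a)\<^sup>2 + 2 * pi * coeff_sqsum P + 2 * Re (cnj a * 0))) {0..2 * pi}"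
    by (intro has_integral_add has_integral_mult_right pCons has_integral_const_real[THEN has_integral_eq_rhs]) auto
  moreover have "(cmod a)\<^sup>2 + (cmod (poly P (cis t)))\<^sup>2 + 2 * Re (cnj a * (cis t * poly P (cis t)))
      = (cmod (poly (pCons a P) (cis t)))\<^sup>2" for t
  proof -
    have "(cmod (a + z))\<^sup>2 = (cmod a)\<^sup>2 + (cmod z)\<^sup>2 + 2 * Re (cnj a * z)" for z
      unfolding cmod_power2 by (simp add: power2_eq_square algebra_simps)
    from this[of "cis t * poly P (cis t)"] show ?thesis
      by (simp add: norm_mult)
  qed
  ultimately show ?case by (simp add: coeff_sqsum_pCons algebra_simps)
qed

text \<open>On the circle the conjugate of \<open>z\<close> is \<open>1/z\<close>, so a real-linear
  functional is \<open>a z + cnj a / z\<close>, and a power of \<open>z\<close> clears the negative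
  exponents that arise in sums and products.\<close>

lemma real_polynomial_function_circle:
  assumes "real_polynomial_function (h :: complex \<Rightarrow> real)"
  shows "\<exists>m P. \<forall>z. cmod z = 1 \<longrightarrow> z ^ m * of_real (h z) = poly P z"
  using assms
proof induction
  case (linear f)
  define a where "a = (of_real (f 1) - \<i> * of_real (f \<i>)) / 2"
  have "z ^ 1 * of_real (f z) = poly [:cnj a, 0, a:] z" if "cmod z = 1" for z
  proof -
    have "f z = f (Re z *\<^sub>R 1 + Im z *\<^sub>R \<i>)"
      by (rule arg_cong[where f = f]) (simp add: complex_eq_iff)
    also have "\<dots> = Re z * f 1 + Im z * f \<i>"
      using linear by (simp add: linear_simps)
    finally have fz: "f z = Re z * f 1 + Im z * f \<i>" .
    then have "of_real (f z) = a * z + cnj a * cnj z"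
      by (simp add: a_def complex_eq_iff field_simps)
    moreover have "z * cnj z = 1"
      using that by (simp add: complex_norm_square[symmetric])
    ultimately show ?thesis by (simp add: algebra_simps)
  qed
  then show ?case by blast
next
  case (const c)
  have "z ^ 0 * of_real c = poly [:of_real c:] z" for z by simp
  then show ?case by blast
next
  case (add f g)
  then obtain m P n Q where *: "\<And>z. cmod z = 1 \<Longrightarrow> z ^ m * of_real (f z) = poly P z"
    "\<And>z. cmod z = 1 \<Longrightarrow> z ^ n * of_real (g z) = poly Q z" by blast
  have "z ^ (m + n) * of_real (f z + g z) = poly (monom 1 n * P + monom 1 m * Q) z" if "cmod z = 1" for z
    using *[OF that, symmetric] by (simp add: poly_monom power_add algebra_simps)
  then show ?case by blast
next
  case (mult f g)
  then obtain m P n Q where *: "\<And>z. cmod z = 1 \<Longrightarrow> z ^ m * of_real (f z) = poly P z"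
    "\<And>z. cmod z = 1 \<Longrightarrow> z ^ n * of_real (g z) = poly Q z" by blast
  have "z ^ (m + n) * of_real (f z * g z) = poly (P * Q) z" if "cmod z = 1" for z
    using *[OF that, symmetric] by (simp add: power_add algebra_simps)
  then show ?case by blast
qed

lemma trig_polynomial_approx:
  fixes h :: "complex \<Rightarrow> complex"
  assumes h: "continuous_on (sphere 0 1) h" and e: "0 < e"
  obtains m P where "0 < m" "\<And>z. cmod z = 1 \<Longrightarrow> cmod (poly P z - z ^ m * h z) < e"
proof -
  obtain g where g: "polynomial_function g" "\<And>z. cmod z = 1 \<Longrightarrow> norm (h z - g z) < e"
    using Stone_Weierstrass_polynomial_function[OF _ h e] by auto
  have "real_polynomial_function (Re \<circ> g)" "real_polynomial_function (Im \<circ> g)"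
    using g(1) bounded_linear_Re bounded_linear_Im by (auto simp: polynomial_function_def)
  then obtain m P n Q where *: "\<And>z. cmod z = 1 \<Longrightarrow> z ^ m * of_real (Re (g z)) = poly P z"
    "\<And>z. cmod z = 1 \<Longrightarrow> z ^ n * of_real (Im (g z)) = poly Q z"
    using real_polynomial_function_circle by (metis comp_apply)
  \<comment> \<open>The extra factor \<open>monom 1 1\<close> only makes the exponent
    positive.\<close>
  define R where "R = monom 1 1 * (monom 1 n * P + monom \<i> m * Q)"
  have R: "poly R z = z ^ (m + n + 1) * g z" if "cmod z = 1" for z
  proof -
    have "g z = of_real (Re (g z)) + \<i> * of_real (Im (g z))" by (rule complex_eq)
    then have "z ^ (m + n + 1) * g z = z ^ (m + n + 1) * (of_real (Re (g z)) + \<i> * of_real (Im (g z)))"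
      by simp
    also have "\<dots> = poly R z"
      unfolding R_def by (simp add: *[OF that, symmetric] poly_monom power_add algebra_simps)
    finally show ?thesis by simp
  qed
  show thesis
  proof
    show "0 < m + n + 1" by simp
    fix z :: complex assume z: "cmod z = 1"
    have "poly R z - z ^ (m + n + 1) * h z = z ^ (m + n + 1) * (g z - h z)"
      by (simp only: R[OF z] right_diff_distrib)
    then show "cmod (poly R z - z ^ (m + n + 1) * h z) < e"
      using g(2)[OF z] by (simp only: norm_mult norm_power z norm_minus_commute) simp
  qed
qed

section \<open>Damping functions and their analytic counterparts\<close>

text \<open>The Cayley transform from the open unit disc to the right half-plane, with value 1 at
  the origin; its real part is the Poisson kernel.\<close>

definition herglotz :: "complex \<Rightarrow> complex" where
  "herglotz v = (1 + v) / (1 - v)"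

lemma Re_herglotz: "Re (herglotz v) = (1 - (cmod v)\<^sup>2) / (cmod (1 - v))\<^sup>2"
  unfolding herglotz_def Re_divide' cmod_power2 by (simp add: power2_eq_square algebra_simps)

lemma Re_herglotz_nonneg: "cmod v \<le> 1 \<Longrightarrow> 0 \<le> Re (herglotz v)"
  by (simp add: Re_herglotz power_le_one)

text \<open>On the unit circle, with \<open>v = r z\<^sup>k\<close>, the damping function times
  \<open>exp (c (herglotz v - 1))\<close> has constant modulus \<open>exp (- c)\<close>; the second factor is
  analytic and equals \<open>1\<close> at \<open>v = 0\<close>. As \<open>r\<close> tends to \<open>1\<close> the damping function tends to
  \<open>1\<close> almost everywhere.\<close>

definition damping :: "real \<Rightarrow> real \<Rightarrow> nat \<Rightarrow> complex \<Rightarrow> real" where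
  "damping c r k z = exp (- c * Re (herglotz (of_real r * z ^ k)))"

lemma damping_pos: "0 < damping c r k z"
  by (simp add: damping_def)

lemma damping_le_1:
  assumes "0 \<le> c" "0 \<le> r" "r \<le> 1" "cmod z = 1"
  shows "damping c r k z \<le> 1"
  using assms by (simp add: damping_def Re_herglotz_nonneg norm_mult norm_power)

lemma continuous_on_damping:
  assumes "0 < r" "r < 1"
  shows "continuous_on (sphere 0 1) (damping c r k)"
proof -
  have "of_real r * z ^ k \<noteq> 1" if "cmod z = 1" for z
  proof
    assume "of_real r * z ^ k = 1"
    then have "cmod (of_real r * z ^ k) = 1" by simp
    with assms that show False by (simp add: norm_mult norm_power)
  qed
  then show ?thesis
    unfolding damping_def herglotz_def by (intro continuous_intros) auto
qed

lemma countable_root_angles: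
  assumes "0 < k"
  shows "countable {t. cis t ^ k = 1}"
proof -
  have "{t. cis t ^ k = 1} \<subseteq> range (\<lambda>n::int. of_int n * (2 * pi) / real k)"
  proof
    fix t assume "t \<in> {t. cis t ^ k = 1}"
    then have "cis (real k * t) = 1"
      by (simp add: Complex.DeMoivre)
    then have "exp (\<i> * of_real (real k * t)) = 1"
      by (simp only: cis_conv_exp)
    then obtain n :: int where "real k * t = of_int (2 * n) * pi"
      unfolding exp_eq_1 by auto
    then have "t = of_int n * (2 * pi) / real k" using assms by (simp add: field_simps)
    then show "t \<in> range (\<lambda>n::int. of_int n * (2 * pi) / real k)" by (rule range_eqI)
  qed
  then show ?thesis by (rule countable_subset) simp
qed

text \<open>Dominated convergence with bound 1. As \<open>r\<close> tends to 1, the numerator in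
  \<open>Re_herglotz\<close> tends to 0, while the denominator stays away from 0 unless
  \<open>cis t ^ k = 1\<close>; these exceptional angles form a null set.\<close>

lemma damping_L2_limit:
  assumes c: "0 \<le> c" and k: "0 < k" and e: "0 < e"
  obtains r where "0 < r" "r < 1"
    "integral {0..2 * pi} (\<lambda>t. (1 - damping c r k (cis t))\<^sup>2) < e"
proof -
  define r where "r n = real (Suc n) / real (Suc (Suc n))" for n
  have r: "0 < r n" "r n < 1" for n by (auto simp: r_def)
  have r_lim: "r \<longlonglongrightarrow> 1"
    unfolding r_def using LIMSEQ_n_over_Suc_n[THEN LIMSEQ_Suc] by simp
  define N where "N = {t. cis t ^ k = 1}"
  define S where "S = {0..2 * pi} - N"
  define f where "f n t = (1 - damping c (r n) k (cis t))\<^sup>2" for n t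
  have negl: "negligible N"
    unfolding N_def using countable_root_angles[OF k] by (simp add: negligible_iff_null_sets null_sets_completionI countable_imp_null_set_lborel)
  have int: "f n integrable_on {0..2 * pi}" for n
    unfolding f_def
    by (intro integrable_continuous_real continuous_intros
        continuous_on_compose2[OF continuous_on_damping[OF r]]) auto
  have spike: "integral S (f n) = integral {0..2 * pi} (f n)" for n
    unfolding S_def by (rule integral_spike_set) (auto intro: negligible_subset[OF negl])
  have "(\<lambda>n. integral S (f n)) \<longlonglongrightarrow> integral S (\<lambda>t. 0)"
  proof (rule dominated_convergence(2))
    have *: "g integrable_on S" if "g integrable_on {0..2 * pi}" for g :: "real \<Rightarrow> real"
      by (rule integrable_spike_set[OF that]) (auto simp: S_def intro: negligible_subset[OF negl])
    show "f n integrable_on S" for n by (rule *[OF int])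
    show "(\<lambda>t. 1 :: real) integrable_on S" by (rule *) (rule integrable_const_ivl)
    show "norm (f n t) \<le> 1" for n t
      using damping_le_1[OF c less_imp_le[OF r(1)] less_imp_le[OF r(2)], of "cis t" n k]
        damping_pos[of c "r n" k "cis t"]
      by (auto simp: f_def abs_square_le_1)
    show "(\<lambda>n. f n t) \<longlonglongrightarrow> 0" if "t \<in> S" for t
    proof -
      have ne: "1 - cis t ^ k \<noteq> 0" using that by (auto simp: S_def N_def)
      have "(\<lambda>n. f n t) \<longlonglongrightarrow> (1 - exp (- c * ((1 - (cmod (of_real 1 * cis t ^ k))\<^sup>2) / (cmod (1 - of_real 1 * cis t ^ k))\<^sup>2)))\<^sup>2"
        unfolding f_def damping_def Re_herglotz using ne
        by (intro tendsto_intros r_lim) auto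
      then show ?thesis by (simp add: norm_power)
    qed
  qed
  then have "(\<lambda>n. integral {0..2 * pi} (f n)) \<longlonglongrightarrow> 0" by (simp add: spike)
  then have "\<forall>\<^sub>F n in sequentially. integral {0..2 * pi} (f n) < e"
    using e by (rule order_tendstoD)
  then obtain n where "integral {0..2 * pi} (f n) < e"
    by (auto simp: eventually_sequentially)
  then show thesis using that[OF r, of n] by (simp add: f_def[abs_def])
qed

text \<open>A Taylor polynomial of a function holomorphic in the open unit disc approximates it
  uniformly on a smaller disc. The constant coefficient is exactly 1, which gives the form
  \<open>1 + v * poly P v\<close>.\<close>

lemma exp_herglotz_poly_approx:
  assumes r: "0 < r" "r < 1" and e: "0 < e"
  obtains P where "\<And>v. cmod v \<le> r \<Longrightarrow>
    cmod (1 + v * poly P v - exp (of_real c * (herglotz v - 1))) < e"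
proof -
  define g where "g v = exp (of_real c * (herglotz v - 1))" for v
  define a where "a n = (deriv ^^ n) g 0 / fact n" for n
  have hol: "g holomorphic_on ball 0 1"
    unfolding g_def herglotz_def by (intro holomorphic_intros) auto
  have sums: "(\<lambda>n. a n * v ^ n) sums g v" if "cmod v < 1" for v
    using holomorphic_power_series[OF hol, of v] that by (simp add: a_def)
  \<comment> \<open>Convergence at a point strictly between \<open>r\<close> and 1 makes the radius
    of convergence exceed \<open>r\<close>.\<close>
  define s where "s = (r + 1) / 2"
  have s: "r < s" "s < 1" using r by (auto simp: s_def)
  have "summable (\<lambda>n. a n * of_real s ^ n)"
    using sums[of "of_real s"] r s by (auto simp: sums_iff)
  then have "ereal s \<le> conv_radius a"
    using conv_radius_geI[of a "of_real s"] r s by simp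
  then have "ereal r < conv_radius a"
    using s by (metis ereal_less_eq(3) less_ereal.simps(1) order_less_le_trans)
  from powser_uniform_limit[OF this, of 0]
  have "\<forall>\<^sub>F n in sequentially. \<forall>v\<in>cball 0 r. dist (\<Sum>i<n. a i * v ^ i) (\<Sum>i. a i * v ^ i) < e"
    using e by (simp add: uniform_limit_iff)
  then obtain n0 where n0: "\<And>n v. n \<ge> n0 \<Longrightarrow> cmod v \<le> r \<Longrightarrow> dist (\<Sum>i<n. a i * v ^ i) (\<Sum>i. a i * v ^ i) < e"
    unfolding eventually_sequentially by (metis mem_cball_0)
  have a0: "a 0 = 1" by (simp add: a_def g_def herglotz_def)
  define P where "P = (\<Sum>i<n0. monom (a (Suc i)) i)"
  show thesis
  proof
    fix v assume v: "cmod v \<le> r"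
    have "(\<Sum>i<Suc n0. a i * v ^ i) = 1 + v * poly P v"
      unfolding sum.lessThan_Suc_shift P_def
      by (simp add: a0 poly_sum poly_monom sum_distrib_left algebra_simps)
    moreover have "(\<Sum>i. a i * v ^ i) = g v"
      using sums[of v] v r by (simp add: sums_iff)
    ultimately show "cmod (1 + v * poly P v - exp (of_real c * (herglotz v - 1))) < e"
      using n0[of "Suc n0" v] v by (simp add: dist_norm g_def)
  qed
qed

text \<open>\<open>R\<close> acts as a polynomial substitute for \<open>z^(-k)\<close>: the error
  may be large near the \<open>k\<close>-th roots of unity, but damping compensates for it exactly
  there.\<close>

lemma damped_inverse_power_approx:
  assumes c: "0 \<le> c" and r: "0 < r" "r < 1" and e: "0 < e"
  obtains R where "\<And>z. cmod z = 1 \<Longrightarrow>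
    cmod (poly R z * z ^ k - 1) * damping c r k z < exp (- c) + e"
proof -
  obtain P where P: "\<And>v. cmod v \<le> r \<Longrightarrow>
    cmod (1 + v * poly P v - exp (of_real c * (herglotz v - 1))) < e"
    using exp_herglotz_poly_approx[OF r e, of c] by blast
  \<comment> \<open>Chosen so that \<open>poly R z * z ^ k = - v * poly P v\<close> for
    \<open>v = r z^k\<close>.\<close>
  define R where "R = smult (- of_real r) (pcompose P (monom (of_real r) k))"
  show thesis
  proof
    fix z :: complex assume z: "cmod z = 1"
    define v where "v = of_real r * z ^ k"
    have v: "cmod v = r" using z r by (simp add: v_def norm_mult norm_power)
    have "cmod (poly R z * z ^ k - 1) = cmod (1 + v * poly P v)"
    proof -
      have "poly R z * z ^ k - 1 = - (1 + v * poly P v)"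
        by (simp add: R_def poly_pcompose poly_monom v_def)
      then show ?thesis by (simp only: norm_minus_cancel)
    qed
    also have "\<dots> < cmod (exp (of_real c * (herglotz v - 1))) + e"
      using P[of v] v norm_triangle_sub[of "1 + v * poly P v" "exp (of_real c * (herglotz v - 1))"]
      by linarith
    also have "cmod (exp (of_real c * (herglotz v - 1))) = exp (c * Re (herglotz v) - c)"
      by (simp add: right_diff_distrib)
    finally have "cmod (poly R z * z ^ k - 1) * damping c r k z
        < (exp (c * Re (herglotz v) - c) + e) * damping c r k z"
      by (intro mult_strict_right_mono damping_pos)
    also have "\<dots> = exp (- c) + e * damping c r k z"
      by (simp add: damping_def v_def algebra_simps flip: exp_add)
    also have "\<dots> \<le> exp (- c) + e"
      using damping_le_1[OF c _ _ z, of r k] r e by (simp add: mult_left_le)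
    finally show "cmod (poly R z * z ^ k - 1) * damping c r k z < exp (- c) + e" .
  qed
qed

section \<open>The transitivity estimate on the circle\<close>

text \<open>The values of \<open>- f\<close> on the circle form a differentiable image of the line
  in the plane, hence a null set, and some small \<open>d\<close> avoids it.\<close>

lemma poly_circle_shift_nonzero:
  assumes "0 < e"
  obtains d where "cmod d < e" "\<And>z. cmod z = 1 \<Longrightarrow> poly f z + d \<noteq> 0"
proof -
  have "(\<lambda>t. - poly f (cis t)) differentiable_on UNIV"
    unfolding differentiable_on_def
  proof
    fix t :: real
    have "(cis has_vector_derivative \<i> * cis t) (at t)"
      unfolding has_vector_derivative_def by (auto intro!: derivative_eq_intros)
    from field_vector_diff_chain_at[OF this poly_DERIV, of f]
    show "(\<lambda>t. - poly f (cis t)) differentiable at t"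
      by (auto simp: has_vector_derivative_def differentiable_def o_def intro!: has_derivative_minus)
  qed
  then have "negligible (range (\<lambda>t. - poly f (cis t)))"
    by (intro negligible_differentiable_image_lowdim) auto
  moreover have "\<not> negligible (ball (0 :: complex) e)"
    using assms by (intro open_not_negligible) auto
  ultimately obtain d where d: "d \<in> ball 0 e" "d \<notin> range (\<lambda>t. - poly f (cis t))"
    using negligible_subset by blast
  show thesis
  proof
    show "cmod d < e" using d by simp
    fix z :: complex assume "cmod z = 1"
    then have "z = cis (Arg z)"
      by (metis cis_Arg sgn_eq norm_zero zero_neq_one div_by_1 of_real_1)
    moreover have "d \<noteq> - poly f (cis (Arg z))" using d(2) by blast
    ultimately have "d \<noteq> - poly f z" by simp
    then show "poly f z + d \<noteq> 0" by (simp add: eq_neg_iff_add_eq_0 add.commute)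
  qed
qed


lemma poly_circle_bound:
  fixes P :: "complex poly"
  obtains C where "0 < C" "\<And>z. cmod z = 1 \<Longrightarrow> cmod (poly P z) \<le> C"
proof -
  have "compact (poly P ` sphere 0 1)"
    by (intro compact_continuous_image continuous_intros) auto
  then have "bounded (poly P ` sphere 0 1)" by (rule compact_imp_bounded)
  then show thesis using that by (auto simp: bounded_pos)
qed

text \<open>Parseval turns a pointwise bound into a coefficient bound, via
  \<open>(x + y)^2 <= 2 x^2 + 2 y^2\<close>; dividing by \<open>2 * pi\<close> leaves a factor
  \<open>1 / pi\<close> before \<open>C^2 * I\<close>, which is estimated by 1.\<close>

lemma coeff_sqsum_damping_bound:
  assumes r: "0 < r" "r < 1" and I: "integral {0..2 * pi} (\<lambda>t. (1 - damping c r k (cis t))\<^sup>2) \<le> I"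
    and bound: "\<And>z. cmod z = 1 \<Longrightarrow> cmod (poly P z) \<le> a + C * (1 - damping c r k z)"
  shows "coeff_sqsum P \<le> 2 * a\<^sup>2 + C\<^sup>2 * I"
proof -
  let ?f = "\<lambda>t. (1 - damping c r k (cis t))\<^sup>2"
  have int: "?f integrable_on {0..2 * pi}"
    by (intro integrable_continuous_real continuous_intros
        continuous_on_compose2[OF continuous_on_damping[OF r]]) auto
  have "((\<lambda>t. 2 * a\<^sup>2 + (2 * C\<^sup>2) * ?f t) has_integral
      ((2 * pi - 0) *\<^sub>R (2 * a\<^sup>2) + (2 * C\<^sup>2) * integral {0..2 * pi} ?f)) {0..2 * pi}"
    by (intro has_integral_add has_integral_mult_right integrable_integral[OF int]
        has_integral_const_real[THEN has_integral_eq_rhs]) auto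
  then have "2 * pi * coeff_sqsum P \<le> (2 * pi - 0) *\<^sub>R (2 * a\<^sup>2) + (2 * C\<^sup>2) * integral {0..2 * pi} ?f"
  proof (rule has_integral_le[OF parseval])
    fix t
    have "(cmod (poly P (cis t)))\<^sup>2 \<le> (a + C * (1 - damping c r k (cis t)))\<^sup>2"
      by (intro power_mono bound) auto
    also have "\<dots> \<le> 2 * a\<^sup>2 + (2 * C\<^sup>2) * ?f t"
      using sum_squares_bound[of a "C * (1 - damping c r k (cis t))"]
      by (simp add: power2_sum power_mult_distrib)
    finally show "(cmod (poly P (cis t)))\<^sup>2 \<le> 2 * a\<^sup>2 + (2 * C\<^sup>2) * ?f t" .
  qed
  also have "\<dots> \<le> 2 * pi * (2 * a\<^sup>2) + (2 * C\<^sup>2) * I"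
    using I by (simp add: mult_left_mono)
  also have "\<dots> \<le> 2 * pi * (2 * a\<^sup>2 + C\<^sup>2 * I)"
  proof -
    have "0 \<le> integral {0..2 * pi} ?f" by (intro integral_nonneg int) auto
    then have "1 * (C\<^sup>2 * I) \<le> pi * (C\<^sup>2 * I)"
      using I pi_gt3 by (intro mult_right_mono) auto
    then show ?thesis by (simp add: algebra_simps)
  qed
  finally show ?thesis by simp
qed

text \<open>\<open>F\<close> is
  \<open>z\<^sup>m\<close> times a damped perturbation of \<open>f\<close> without zeros on the circle, and \<open>p\<close> combines
  a trigonometric approximation of \<open>g / f\<close> with an analytic approximation of the
  negative power of \<open>z\<close> that it contains.\<close>

lemma circle_transitivity:
  fixes f g :: "complex poly"
  assumes e: "0 < e"
  obtains m F p where "coeff_sqsum (F - monom 1 m * f) < e" "coeff_sqsum (p * F - monom 1 m * g) < e"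
proof -
  \<comment> \<open>In the final bound \<open>2 * a^2 + C^2 * I\<close> each summand gets at most
    half of \<open>e\<close>.\<close>
  define a where "a = sqrt e / 4"
  have a: "0 < a" "2 * a\<^sup>2 < e / 2" using e by (auto simp: a_def power_divide)
  obtain d where d: "cmod d < a / 2" "\<And>z. cmod z = 1 \<Longrightarrow> poly f z + d \<noteq> 0"
    using poly_circle_shift_nonzero[of "a / 2" f] a by auto
  define f1 where "f1 = f + [:d:]"
  have f1: "poly f1 z = poly f z + d" for z by (simp add: f1_def)
  have f1_nz: "poly f1 z \<noteq> 0" if "cmod z = 1" for z using d(2)[OF that] by (simp add: f1)
  obtain A where A: "0 < A" "\<And>z. cmod z = 1 \<Longrightarrow> cmod (poly f1 z) \<le> A"
    using poly_circle_bound[of f1] by blast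
  obtain B where B: "0 < B" "\<And>z. cmod z = 1 \<Longrightarrow> cmod (poly g z) \<le> B"
    using poly_circle_bound[of g] by blast
  obtain k s where k: "0 < k"
    and s: "\<And>z. cmod z = 1 \<Longrightarrow> cmod (poly s z - z ^ k * (poly g z / poly f1 z)) < a / (4 * A)"
  proof (rule trig_polynomial_approx[of "\<lambda>z. poly g z / poly f1 z" "a / (4 * A)"])
    show "continuous_on (sphere 0 1) (\<lambda>z. poly g z / poly f1 z)"
      by (intro continuous_intros) (auto simp: f1_nz)
  qed (use a A in auto)
  have s': "cmod (poly s z * poly f1 z - z ^ k * poly g z) \<le> a / 4" if z: "cmod z = 1" for z
  proof -
    have "poly s z * poly f1 z - z ^ k * poly g z = (poly s z - z ^ k * (poly g z / poly f1 z)) * poly f1 z"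
      using f1_nz[OF z] by (simp add: field_simps)
    then have "cmod (poly s z * poly f1 z - z ^ k * poly g z) \<le> a / (4 * A) * A"
      unfolding norm_mult[symmetric] by (simp only: norm_mult) (intro mult_mono s[OF z, THEN less_imp_le] A(2)[OF z]; use a A in simp)
    then show ?thesis using A by simp
  qed
  obtain D where D: "0 < D" "\<And>z. cmod z = 1 \<Longrightarrow> cmod (poly (s * f1) z) \<le> D"
    using poly_circle_bound[of "s * f1"] by blast
  \<comment> \<open>Makes the residual modulus \<open>exp (- c)\<close> small against the bound
    \<open>D\<close> of \<open>s * f1\<close>.\<close>
  define c where "c = max 0 (- ln (a / (4 * D)))"
  have c: "0 \<le> c" "exp (- c) \<le> a / (4 * D)"
  proof -
    have "exp (- c) \<le> exp (ln (a / (4 * D)))" by (simp add: c_def)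
    then show "exp (- c) \<le> a / (4 * D)" using a D by (simp add: exp_ln)
  qed (simp add: c_def)
  \<comment> \<open>A common bound for \<open>f1\<close> and \<open>g\<close>, so that one damping
    parameter \<open>r\<close> serves both estimates.\<close>
  define C where "C = max A B"
  define I where "I = e / (2 * (C\<^sup>2 + 1))"
  have "0 < I" using e by (simp add: I_def add_nonneg_pos)
  then obtain r where r: "0 < r" "r < 1"
    and r_int: "integral {0..2 * pi} (\<lambda>t. (1 - damping c r k (cis t))\<^sup>2) < I"
    using damping_L2_limit[OF c(1) k] by blast
  have CI: "2 * a\<^sup>2 + C\<^sup>2 * I < e"
  proof -
    have "C\<^sup>2 * I \<le> (C\<^sup>2 + 1) * I" using \<open>0 < I\<close> by (simp add: algebra_simps)
    also have "\<dots> = e / 2"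
    proof -
      have "C\<^sup>2 + 1 \<noteq> 0" by (smt (verit) zero_le_power2)
      then show ?thesis by (simp add: I_def field_simps)
    qed
    finally show ?thesis using a by simp
  qed
  obtain R where R: "\<And>z. cmod z = 1 \<Longrightarrow>
      cmod (poly R z * z ^ k - 1) * damping c r k z < exp (- c) + a / (4 * D)"
    using damped_inverse_power_approx[OF c(1) r, of "a / (4 * D)" k] a D by auto
  define p where "p = R * s"
  obtain G where G: "0 < G" "\<And>z. cmod z = 1 \<Longrightarrow> cmod (poly p z) \<le> G"
    using poly_circle_bound[of p] by blast
  \<comment> \<open>\<open>p\<close> is fixed before \<open>F\<close>, so the approximation error
    \<open>h\<close> of \<open>F\<close> can be chosen small against the bound \<open>G\<close> of
    \<open>p\<close>.\<close>
  define h where "h = min (a / 2) (a / (4 * G))"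
  have h: "0 < h" "h \<le> a / 2" "G * h \<le> a / 4"
  proof -
    have "G * h \<le> G * (a / (4 * G))" using G by (intro mult_left_mono) (auto simp: h_def)
    then show "G * h \<le> a / 4" using G by simp
  qed (use a G in \<open>auto simp: h_def\<close>)
  obtain m F where F: "\<And>z. cmod z = 1 \<Longrightarrow>
      cmod (poly F z - z ^ m * (of_real (damping c r k z) * poly f1 z)) < h"
  proof (rule trig_polynomial_approx[of "\<lambda>z. of_real (damping c r k z) * poly f1 z" h])
    show "continuous_on (sphere 0 1) (\<lambda>z. of_real (damping c r k z) * poly f1 z)"
      by (intro continuous_intros continuous_on_damping r)
  qed (use h in auto)
  show thesis
  proof
    have "coeff_sqsum (F - monom 1 m * f) \<le> 2 * a\<^sup>2 + C\<^sup>2 * I"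
    proof (rule coeff_sqsum_damping_bound[OF r less_imp_le[OF r_int]])
      fix z :: complex assume z: "cmod z = 1"
      let ?w = "damping c r k z"
      have w: "0 < ?w" "?w \<le> 1"
        using damping_pos damping_le_1[OF c(1) _ _ z] r by auto
      have "poly (F - monom 1 m * f) z = (poly F z - z ^ m * (of_real ?w * poly f1 z))
          + z ^ m * (d - of_real (1 - ?w) * poly f1 z)"
        by (simp add: poly_monom f1 algebra_simps)
      also have "cmod \<dots> \<le> cmod (poly F z - z ^ m * (of_real ?w * poly f1 z))
          + cmod (z ^ m * (d - of_real (1 - ?w) * poly f1 z))"
        by (rule norm_triangle_ineq)
      also have "cmod (z ^ m * (d - of_real (1 - ?w) * poly f1 z)) = cmod (d - of_real (1 - ?w) * poly f1 z)"
        by (simp add: norm_mult norm_power z)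
      also have "\<dots> \<le> cmod d + cmod (of_real (1 - ?w) * poly f1 z)"
        by (rule norm_triangle_ineq4)
      also have "cmod (of_real (1 - ?w) * poly f1 z) = (1 - ?w) * cmod (poly f1 z)"
        using w by (simp only: norm_mult norm_of_real)
      also have "\<dots> \<le> (1 - ?w) * C"
        using A(2)[OF z] w by (intro mult_left_mono) (auto simp: C_def)
      finally show "cmod (poly (F - monom 1 m * f) z) \<le> a + C * (1 - ?w)"
        using F[OF z] h d by (simp add: mult.commute)
    qed
    then show "coeff_sqsum (F - monom 1 m * f) < e" using CI by linarith
    have "coeff_sqsum (p * F - monom 1 m * g) \<le> 2 * a\<^sup>2 + C\<^sup>2 * I"
    proof (rule coeff_sqsum_damping_bound[OF r less_imp_le[OF r_int]])
      fix z :: complex assume z: "cmod z = 1"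
      let ?w = "damping c r k z"
      have w: "0 < ?w" "?w \<le> 1"
        using damping_pos damping_le_1[OF c(1) _ _ z] r by auto
      \<comment> \<open>Four sources of error: \<open>R\<close> in place of \<open>z^(-k)\<close>,
        \<open>s\<close> in place of \<open>z^k g / f1\<close>, the damping of \<open>g\<close>, and
        the approximation \<open>F\<close>. Multiplying by \<open>z^k\<close> keeps the modulus and
        avoids negative powers. All but the damping error add up to at most
        \<open>a\<close>.\<close>
      let ?u = "(poly R z * z ^ k - 1) * of_real ?w * poly (s * f1) z"
      let ?v = "(poly s z * poly f1 z - z ^ k * poly g z) * of_real ?w"
      let ?x = "z ^ k * poly g z * of_real (1 - ?w)"
      let ?y = "poly p z * (poly F z - z ^ m * (of_real ?w * poly f1 z))"
      have "z ^ k * poly (p * F - monom 1 m * g) z = z ^ k * ?y + z ^ m * (?u + ?v - ?x)"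
        by (simp add: poly_monom p_def algebra_simps)
      then have "cmod (z ^ k * poly (p * F - monom 1 m * g) z) = cmod (z ^ k * ?y + z ^ m * (?u + ?v - ?x))"
        by (rule arg_cong)
      also have "\<dots> \<le> cmod (z ^ k * ?y) + cmod (z ^ m * (?u + ?v - ?x))"
        by (rule norm_triangle_ineq)
      also have "\<dots> = cmod ?y + cmod (?u + ?v - ?x)"
        by (simp only: norm_mult[of "z ^ k"] norm_mult[of "z ^ m"] norm_power z power_one mult_1_left)
      also have "\<dots> \<le> cmod ?y + (cmod ?u + cmod ?v + cmod ?x)"
        by (intro add_left_mono norm_triangle_le_diff norm_triangle_le add_right_mono) simp
      finally have *: "cmod (z ^ k * poly (p * F - monom 1 m * g) z) \<le> cmod ?y + (cmod ?u + cmod ?v + cmod ?x)" .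
      have "cmod ?y \<le> G * h"
        using G(2)[OF z] F[OF z] G(1) h(1) unfolding norm_mult by (intro mult_mono) auto
      moreover have "cmod ?u \<le> (exp (- c) + a / (4 * D)) * D"
        using R[OF z] D(2)[OF z] D(1) w a unfolding norm_mult norm_of_real
        by (intro mult_mono) (auto intro: add_nonneg_nonneg)
      moreover have "\<dots> \<le> a / 2"
      proof -
        have "(exp (- c) + a / (4 * D)) * D \<le> (a / (4 * D) + a / (4 * D)) * D"
          using c D by (intro mult_right_mono) auto
        also have "\<dots> = a / 2" using D by (simp add: field_simps)
        finally show ?thesis .
      qed
      moreover have "cmod ?v \<le> a / 4 * 1"
        using s'[OF z] w a unfolding norm_mult norm_of_real by (intro mult_mono) auto
      moreover have "cmod ?x \<le> C * (1 - ?w)"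
        using B(2)[OF z] w unfolding norm_mult norm_of_real norm_power z
        by (simp add: C_def) (intro mult_right_mono, auto)
      moreover have "cmod (z ^ k * poly (p * F - monom 1 m * g) z) = cmod (poly (p * F - monom 1 m * g) z)"
        by (simp only: norm_mult norm_power z power_one mult_1_left)
      ultimately show "cmod (poly (p * F - monom 1 m * g) z) \<le> a + C * (1 - ?w)"
        using * h by linarith
    qed
    then show "coeff_sqsum (p * F - monom 1 m * g) < e" using CI by linarith
  qed
qed


section \<open>Polynomials in an operator on the sequence space\<close>

lemma coord_zero [simp]: "coord 0 v = 0"
  by (simp add: zero_ell2.rep_eq)

lemma coord_scaleC [simp]: "coord (c *\<^sub>C x) v = c * coord x v"
  by (simp add: scaleC.rep_eq)

lemma coord_basis_vec: "coord (basis_vec u) v = (if v = u then 1 else 0)"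
  by (simp add: basis_vec.rep_eq)

lemma coord_sum: "coord (\<Sum>i\<in>I. f i) v = (\<Sum>i\<in>I. coord (f i) v)"
  by (induction I rule: infinite_finite_induct) (simp_all add: coord_add)

lemma norm_scaleC: "norm (c *\<^sub>C x) = cmod c * norm x"
proof -
  have "(\<lambda>v. (cmod (coord x v))\<^sup>2) summable_on UNIV"
    using square_summable_coord[of x] by (simp add: square_summable_def)
  then have "(norm (c *\<^sub>C x))\<^sup>2 = (cmod c * norm x)\<^sup>2"
    by (simp add: norm_ell2_squared norm_mult power_mult_distrib infsum_cmult_right)
  then show ?thesis by simp
qed

lemma scaleR_eq_scaleC: "r *\<^sub>R x = complex_of_real r *\<^sub>C x" for x :: "'v ell2"
  by (rule scaleR_ell2_def)

lemma linear_coord: "linear (\<lambda>x. coord x v)"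
  by (rule linearI) (simp_all add: coord_add scaleR_eq_scaleC scaleR_conv_of_real)

lemma bounded_linear_coord: "bounded_linear (\<lambda>x. coord x v)"
  by (rule bounded_linear.intro[OF linear_coord]) (unfold_locales, metis cmod_coord_le_norm mult_1_right)

lemma cinner_add_left: "cinner (x + y) z = cinner x z + cinner y z"
  by (simp add: cinner_def coord_add ring_distribs infsum_add summable_cinner)

lemma cinner_scaleC_left: "cinner (c *\<^sub>C x) y = c * cinner x y"
  by (simp add: cinner_def mult.assoc infsum_cmult_right summable_cinner)

lemma cinner_commute: "cinner y x = cnj (cinner x y)"
  unfolding cinner_def infsum_cnj[symmetric] by (simp add: mult.commute)

text \<open>Rotating \<open>x\<close> by a phase makes the complex inner product real and
  non-negative, which reduces the claim to the real Cauchy-Schwarz inequality.\<close>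

lemma cmod_cinner_le: "cmod (cinner x y) \<le> norm x * norm y"
proof -
  define c where "c = cnj (sgn (cinner x y))"
  have "complex_of_real (cmod (cinner x y)) = cinner (c *\<^sub>C x) y"
    by (simp add: c_def cinner_scaleC_left sgn_eq complex_norm_square[symmetric] power2_eq_square mult.commute)
  then have "cmod (cinner x y) = (c *\<^sub>C x) \<bullet> y"
    by (metis Re_complex_of_real inner_ell2_def)
  also have "\<dots> \<le> norm (c *\<^sub>C x) * norm y" by (rule norm_cauchy_schwarz)
  also have "\<dots> \<le> norm x * norm y"
    by (intro mult_right_mono) (simp_all add: norm_scaleC c_def norm_sgn)
  finally show ?thesis .
qed

lemma bounded_linear_cinner_left: "bounded_linear (\<lambda>x. cinner x y)"
proof (rule bounded_linear.intro)
  show "linear (\<lambda>x. cinner x y)"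
    by (rule linearI) (simp_all add: cinner_add_left cinner_scaleC_left scaleR_eq_scaleC scaleR_conv_of_real)
  show "bounded_linear_axioms (\<lambda>x. cinner x y)"
    by unfold_locales (use cmod_cinner_le in blast)
qed

lemma cinner_basis_right: "cinner x (basis_vec v) = coord x v"
proof -
  have "cinner x (basis_vec v) = (\<Sum>\<^sub>\<infinity>u\<in>{v}. coord x u * cnj (coord (basis_vec v) u))"
    unfolding cinner_def by (rule infsum_cong_neutral) (auto simp: coord_basis_vec)
  then show ?thesis by (simp add: coord_basis_vec)
qed

lemma cinner_basis_left: "cinner (basis_vec v) x = cnj (coord x v)"
  by (subst cinner_commute) (simp add: cinner_basis_right)

lemma cinner_eq_0_if_disjoint_support:
  assumes "\<And>v. coord x v = 0 \<or> coord y v = 0"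
  shows "cinner x y = 0"
proof -
  have "coord x v * cnj (coord y v) = 0" for v using assms[of v] by auto
  then show ?thesis unfolding cinner_def by (intro infsum_0) auto
qed

lemma norm_basis_vec: "norm (basis_vec v) = 1"
proof -
  have "(norm (basis_vec v))\<^sup>2 = 1"
    by (simp add: power2_norm_eq_inner inner_ell2_def cinner_basis_right coord_basis_vec)
  then show ?thesis by (simp add: power2_eq_1_iff) (metis norm_ge_zero not_one_le_zero neg_0_le_iff_le)
qed

text \<open>The squared error of a finite partial sum is the tail of the convergent series of
  squared moduli.\<close>

lemma has_sum_basis: "((\<lambda>v. coord x v *\<^sub>C basis_vec v) has_sum x) UNIV"
proof -
  let ?f = "\<lambda>v. (cmod (coord x v))\<^sup>2"
  let ?s = "\<lambda>F. \<Sum>v\<in>F. coord x v *\<^sub>C basis_vec v"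
  have summable: "?f summable_on UNIV"
    using square_summable_coord[of x] by (simp add: square_summable_def)
  have coord_s: "coord (?s F) v = (if v \<in> F then coord x v else 0)" if "finite F" for F v
    using that by (simp add: coord_sum coord_basis_vec if_distrib[of "\<lambda>c. _ * c"] cong: if_cong)
  have eq: "norm (?s F - x) = sqrt (infsum ?f UNIV - sum ?f F)" if F: "finite F" for F
  proof -
    have "(norm (?s F - x))\<^sup>2 = (\<Sum>\<^sub>\<infinity>v\<in>UNIV - F. ?f v)"
      unfolding norm_ell2_squared by (rule infsum_cong_neutral) (auto simp: coord_diff coord_s[OF F])
    also have "\<dots> = infsum ?f UNIV - sum ?f F"
      using F summable by (subst infsum_Diff) auto
    finally show ?thesis by (metis norm_ge_zero real_sqrt_unique)
  qed
  have "(sum ?f \<longlongrightarrow> infsum ?f UNIV) (finite_subsets_at_top UNIV)"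
    using has_sum_infsum[OF summable] by (simp add: has_sum_def)
  then have "((\<lambda>F. sqrt (infsum ?f UNIV - sum ?f F)) \<longlongrightarrow> sqrt (infsum ?f UNIV - infsum ?f UNIV))
      (finite_subsets_at_top UNIV)"
    by (intro tendsto_intros)
  then have "((\<lambda>F. norm (?s F - x)) \<longlongrightarrow> 0) (finite_subsets_at_top UNIV)"
    by (subst tendsto_cong[where g = "\<lambda>F. sqrt (infsum ?f UNIV - sum ?f F)"])
      (auto simp: eq intro!: eventually_finite_subsets_at_top_weakI)
  then have "((\<lambda>F. ?s F - x) \<longlongrightarrow> 0) (finite_subsets_at_top UNIV)"
    by (rule tendsto_norm_zero_cancel)
  then show ?thesis
    unfolding has_sum_def by (rule LIM_zero_cancel)
qed

lemma bounded_linear_scaleC: "bounded_linear (\<lambda>x :: 'v ell2. c *\<^sub>C x)"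
proof (rule bounded_linear.intro)
  show "linear (\<lambda>x :: 'v ell2. c *\<^sub>C x)"
    by (rule linearI) (simp_all add: ell2.scale_right_distrib scaleR_eq_scaleC mult.commute)
  show "bounded_linear_axioms (\<lambda>x :: 'v ell2. c *\<^sub>C x)"
    by unfold_locales (metis norm_scaleC mult.commute order_refl)
qed

lemma closure_ell2_subspace_UNIV:
  assumes add: "\<And>x y. x \<in> D \<Longrightarrow> y \<in> D \<Longrightarrow> x + y \<in> D"
    and scale: "\<And>c x. x \<in> D \<Longrightarrow> c *\<^sub>C x \<in> D"
    and basis: "\<And>v. basis_vec v \<in> closure D"
  shows "closure D = UNIV"
proof -
  have add': "x + y \<in> closure D" if "x \<in> closure D" "y \<in> closure D" for x y
  proof -
    have "(\<lambda>p. fst p + snd p) ` closure (D \<times> D) \<subseteq> closure D"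
      by (rule image_closure_subset) (auto intro!: continuous_intros add closure_subset[THEN subsetD])
    with that show ?thesis by (force simp: closure_Times)
  qed
  have scale': "c *\<^sub>C x \<in> closure D" if "x \<in> closure D" for c x
  proof -
    have "(\<lambda>x. c *\<^sub>C x) ` closure D \<subseteq> closure D"
      by (intro image_closure_subset linear_continuous_on bounded_linear_scaleC) (auto intro!: scale closure_subset[THEN subsetD])
    with that show ?thesis by blast
  qed
  have zero: "0 \<in> closure D" using scale'[OF basis, of 0] by simp
  have "x \<in> closure D" for x
  proof (rule Lim_in_closed_set)
    have "(\<Sum>v\<in>F. coord x v *\<^sub>C basis_vec v) \<in> closure D" for F
      by (induction F rule: infinite_finite_induct) (auto intro!: zero add' scale' basis)
    then show "\<forall>\<^sub>F F in finite_subsets_at_top UNIV. (\<Sum>v\<in>F. coord x v *\<^sub>C basis_vec v) \<in> closure D"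
      by simp
    show "((\<lambda>F. \<Sum>v\<in>F. coord x v *\<^sub>C basis_vec v) \<longlongrightarrow> x) (finite_subsets_at_top UNIV)"
      using has_sum_basis[of x] by (simp add: has_sum_def)
  qed auto
  then show ?thesis by blast
qed

section \<open>Polynomial calculus for an operator\<close>

definition poly_op :: "('v ell2 \<Rightarrow> 'v ell2) \<Rightarrow> complex poly \<Rightarrow> 'v ell2 \<Rightarrow> 'v ell2" where
  "poly_op T P x = (\<Sum>i\<le>degree P. coeff P i *\<^sub>C (T ^^ i) x)"

context
  fixes T :: "'v ell2 \<Rightarrow> 'v ell2"
  assumes lin: "Vector_Spaces.linear scaleC scaleC T"
begin

interpretation T: Vector_Spaces.linear scaleC scaleC T by (rule lin)

text \<open>Horner's recursion; the algebraic laws below follow from it by induction on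
  polynomials.\<close>

lemma poly_op_pCons: "poly_op T (pCons a P) x = a *\<^sub>C x + T (poly_op T P x)"
  unfolding poly_op_def
  by (subst sum_coeff_pCons) (simp_all add: T.sum T.scale)

lemma poly_op_0 [simp]: "poly_op T 0 x = 0"
  by (simp add: poly_op_def)

lemma poly_op_zero_right [simp]: "poly_op T P 0 = 0"
  by (induction P) (simp_all add: poly_op_pCons T.zero)

lemma poly_op_add_right: "poly_op T P (x + y) = poly_op T P x + poly_op T P y"
  by (induction P) (simp_all add: poly_op_pCons T.add ell2.scale_right_distrib algebra_simps)

lemma poly_op_scale_right: "poly_op T P (c *\<^sub>C x) = c *\<^sub>C poly_op T P x"
  by (induction P) (simp_all add: poly_op_pCons T.scale ell2.scale_right_distrib mult.commute)

lemma poly_op_add: "poly_op T (P + Q) x = poly_op T P x + poly_op T Q x"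
  by (induction P Q rule: poly_induct2)
    (simp_all add: poly_op_pCons T.add ell2.scale_left_distrib algebra_simps)

lemma poly_op_smult: "poly_op T (smult c P) x = c *\<^sub>C poly_op T P x"
  by (induction P) (simp_all add: poly_op_pCons T.scale ell2.scale_right_distrib)

lemma poly_op_diff: "poly_op T (P - Q) x = poly_op T P x - poly_op T Q x"
proof -
  have "poly_op T P x = poly_op T (P - Q) x + poly_op T Q x"
    by (simp flip: poly_op_add)
  then show ?thesis by simp
qed

lemma poly_op_mult: "poly_op T (P * Q) x = poly_op T P (poly_op T Q x)"
  by (induction P) (simp_all add: poly_op_pCons poly_op_add poly_op_smult mult_pCons_left)

lemma poly_op_monom: "poly_op T (monom 1 n) x = (T ^^ n) x"
  by (induction n) (simp_all add: monom_0 monom_Suc poly_op_pCons T.zero)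

end

lemma bounded_linear_funpow:
  fixes T :: "'a::real_normed_vector \<Rightarrow> 'a"
  assumes "bounded_linear T"
  shows "bounded_linear (T ^^ n)"
proof (induction n)
  case 0
  then show ?case by (simp add: id_def bounded_linear_ident)
next
  case (Suc n)
  then show ?case using bounded_linear_compose[OF assms] by (simp add: o_def)
qed

lemma continuous_on_poly_op:
  assumes "bounded_linear T"
  shows "continuous_on A (poly_op T P)"
  unfolding poly_op_def
  by (intro continuous_on_sum linear_continuous_on
      bounded_linear_compose[OF bounded_linear_scaleC bounded_linear_funpow[OF assms], unfolded o_def])

lemma poly_op_in_span: "poly_op T P h \<in> ell2.span (range (\<lambda>n. (T ^^ n) h))"
  unfolding poly_op_def by (intro ell2.span_sum ell2.span_scale ell2.span_base) auto

text \<open>Baire category: it suffices to move near \<open>x = k + f(T) b\<^sub>n\<close> to some \<open>h\<close> with \<open>P(T) h\<close>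
  near a basis vector \<open>T\<^sup>j (k' + f'(T) b\<^sub>n)\<close>. With \<open>P = M z\<^sup>j + z\<^sup>l p\<close> and \<open>l\<close> large, \<open>P(T)\<close> acts on
  \<open>k\<close> as \<open>0\<close> and on \<open>k'\<close> as \<open>M T\<^sup>j\<close>, so adding the small vector \<open>k' / M\<close> settles the nilpotent
  part, and \<open>circle_transitivity\<close> takes care of the orbit of \<open>b\<close>.\<close>

lemma cyclic_of_backward_orbit:
  fixes T :: "'v ell2 \<Rightarrow> 'v ell2" and b :: "nat \<Rightarrow> 'v ell2"
  assumes T: "bounded_operator T" and contr: "\<And>x. norm (T x) \<le> norm x"
    and ctbl: "countable (UNIV :: 'v set)"
    and b_Suc: "\<And>n. T (b (Suc n)) = b n"
    and b_bound: "\<And>P n. (norm (poly_op T P (b n)))\<^sup>2 \<le> coeff_sqsum P"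
    and decomp: "\<And>v. \<exists>n f k j. basis_vec v = k + poly_op T f (b n) \<and> (T ^^ j) k = 0"
    and surj: "\<And>v. \<exists>w c. T (c *\<^sub>C basis_vec w) = basis_vec v"
  shows "cyclic T"
proof -
  have lin: "Vector_Spaces.linear scaleC scaleC T" using T by blast
  note po = poly_op_add[OF lin] poly_op_smult[OF lin] poly_op_mult[OF lin] poly_op_monom[OF lin]
    poly_op_add_right[OF lin] poly_op_scale_right[OF lin] poly_op_diff[OF lin]
  have contr_pow: "norm ((T ^^ n) x) \<le> norm x" for n x
    by (induction n) (auto intro: order_trans[OF contr])
  have b_pow: "(T ^^ m) (b (n + m)) = b n" for m n
    by (induction m) (simp_all add: b_Suc funpow_Suc_right del: funpow.simps)
  have b_shift: "poly_op T f (b n) = poly_op T (f * monom 1 m) (b (n + m))" for f n m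
    by (simp only: po b_pow)
  have pow_zero: "(T ^^ m) k = 0" if "(T ^^ j) k = 0" "j \<le> m" for j m k
    using that contr_pow[of "m - j" "(T ^^ j) k"]
    by (metis contr_pow le_add_diff_inverse2 funpow_add o_apply norm_zero norm_le_zero_iff)
  \<comment> \<open>The sum of all kernels of powers and of the span of the backward orbit. It is a
    subspace because \<open>b_shift\<close> moves two orbit vectors to a common index.\<close>
  define D where "D = {x. \<exists>n f k j. x = k + poly_op T f (b n) \<and> (T ^^ j) k = 0}"
  have D_add: "x + y \<in> D" if "x \<in> D" "y \<in> D" for x y
  proof -
    obtain n f k j where x: "x = k + poly_op T f (b n)" "(T ^^ j) k = 0"
      using \<open>x \<in> D\<close> by (auto simp: D_def)
    obtain n' f' k' j' where y: "y = k' + poly_op T f' (b n')" "(T ^^ j') k' = 0"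
      using \<open>y \<in> D\<close> by (auto simp: D_def)
    have "x + y = (k + k') + poly_op T (f * monom 1 n' + f' * monom 1 n) (b (n + n'))"
      using x(1) y(1) b_shift[of f n n'] b_shift[of f' n' n]
      by (simp add: po add.commute algebra_simps)
    moreover have "(T ^^ (j + j')) (k + k') = 0"
      using pow_zero[OF x(2), of "j + j'"] pow_zero[OF y(2), of "j + j'"] po(5)[of "monom 1 (j + j')" k k']
      by (simp add: po(4))
    ultimately show ?thesis unfolding D_def by blast
  qed
  have D_scale: "c *\<^sub>C x \<in> D" if "x \<in> D" for c x
  proof -
    obtain n f k j where x: "x = k + poly_op T f (b n)" "(T ^^ j) k = 0"
      using \<open>x \<in> D\<close> by (auto simp: D_def)
    have "c *\<^sub>C x = c *\<^sub>C k + poly_op T (smult c f) (b n)"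
      by (simp add: x po ell2.scale_right_distrib)
    moreover have "(T ^^ j) (c *\<^sub>C k) = 0"
      using x(2) po(6)[of "monom 1 j" c k] by (simp add: po(4))
    ultimately show ?thesis unfolding D_def by blast
  qed
  have basis_D: "basis_vec v \<in> D" for v using decomp[of v] by (auto simp: D_def)
  have D_dense: "closure D = UNIV"
    by (rule closure_ell2_subspace_UNIV) (auto intro!: D_add D_scale basis_D closure_subset[THEN subsetD])
  have surj_pow: "\<exists>w c. (T ^^ n) (c *\<^sub>C basis_vec w) = basis_vec v" for n v
  proof (induction n arbitrary: v)
    case 0
    have "(T ^^ 0) (1 *\<^sub>C basis_vec v) = basis_vec v" by simp
    then show ?case by blast
  next
    case (Suc n)
    obtain w c where w: "T (c *\<^sub>C basis_vec w) = basis_vec v" using surj by blast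
    obtain w' c' where w': "(T ^^ n) (c' *\<^sub>C basis_vec w') = basis_vec w" using Suc by blast
    have "(T ^^ n) (c *\<^sub>C (c' *\<^sub>C basis_vec w')) = c *\<^sub>C basis_vec w"
      using po(6)[of "monom 1 n" c "c' *\<^sub>C basis_vec w'"] w' by (simp only: po(4))
    then have "(T ^^ Suc n) ((c * c') *\<^sub>C basis_vec w') = basis_vec v"
      using w by simp
    then show ?case by blast
  qed
  \<comment> \<open>A vector in all of these countably many open sets is cyclic: polynomials in
    \<open>T\<close> applied to it approximate every basis vector.\<close>
  define U where "U v m = {h. \<exists>P. norm (poly_op T P h - basis_vec v) < 1 / real (Suc m)}" for v m
  have U_open: "open (U v m)" for v m
  proof -
    have "open {h. norm (poly_op T P h - basis_vec v) < 1 / real (Suc m)}" for P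
      by (intro open_Collect_less continuous_intros continuous_on_poly_op) (use T in blast)
    moreover have "U v m = (\<Union>P. {h. norm (poly_op T P h - basis_vec v) < 1 / real (Suc m)})"
      by (auto simp: U_def)
    ultimately show ?thesis by auto
  qed
  have U_dense: "closure (U v m) = UNIV" for v m
  proof -
    have "\<exists>h\<in>U v m. dist h x < e" if x: "x \<in> D" and e: "0 < e" for x e
    proof -
      obtain n f k j where x: "x = k + poly_op T f (b n)" "(T ^^ j) k = 0"
        using \<open>x \<in> D\<close> by (auto simp: D_def)
      \<comment> \<open>The exponent that annihilates \<open>k\<close> is reused, so that
        \<open>M T^j\<close> kills \<open>k\<close> and still reaches the target.\<close>
      obtain w c where w: "(T ^^ j) (c *\<^sub>C basis_vec w) = basis_vec v" using surj_pow by blast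
      have "c *\<^sub>C basis_vec w \<in> D" by (intro D_scale basis_D)
      then obtain n' f' k' j' where z: "c *\<^sub>C basis_vec w = k' + poly_op T f' (b n')" "(T ^^ j') k' = 0"
        by (auto simp: D_def)
      define f1 where "f1 = f * monom 1 n'"
      define f2 where "f2 = f' * monom 1 n"
      \<comment> \<open>\<open>T^l\<close> annihilates both \<open>k\<close> and \<open>k'\<close>,
        hence the summand \<open>z^l p\<close> of \<open>P\<close> sees only the orbit part.\<close>
      define l where "l = j + j'"
      define K where "K = n + n'"
      have x': "x = k + poly_op T f1 (b K)"
        by (simp only: x(1) f1_def K_def b_shift[of f n n'])
      have z': "basis_vec v = (T ^^ j) k' + (T ^^ j) (poly_op T f2 (b K))"
        by (simp only: w[symmetric] z(1) f2_def K_def b_shift[of f' n' n] add.commute[of n n'] po(4)[symmetric] po(5))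
      obtain M :: real where M: "0 < M" "norm k' < M * (e / 2)"
      proof
        show "0 < norm k' * 2 / e + 1" using e by (simp add: add_nonneg_pos)
        show "norm k' < (norm k' * 2 / e + 1) * (e / 2)" using e by (simp add: field_simps)
      qed
      define r where "r = 1 / real (Suc m)"
      \<comment> \<open>Small enough for the distance from \<open>h\<close> to \<open>x\<close> and
        for the output error, in which \<open>M\<close> amplifies \<open>X\<close>.\<close>
      define d where "d = min (e / 2) (r / (2 * (M + 1)))"
      have d: "0 < d" "d \<le> e / 2" "M * d + d \<le> r / 2"
      proof -
        have "(M + 1) * d \<le> (M + 1) * (r / (2 * (M + 1)))"
          using M by (intro mult_left_mono) (auto simp: d_def)
        also have "\<dots> = r / 2" using M by (simp add: field_simps)
        finally show "M * d + d \<le> r / 2" by (simp add: algebra_simps)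
      qed (use e M in \<open>auto simp: d_def r_def\<close>)
      \<comment> \<open>The subtracted term cancels the contribution of \<open>M z\<^sup>j\<close> on the orbit of \<open>b\<close>.\<close>
      define g where "g = monom 1 j * f2 - smult (of_real M) (monom 1 j * f1)"
      have "0 < d\<^sup>2" using d(1) by simp
      then obtain q F p where F: "coeff_sqsum (F - monom 1 q * (monom 1 l * f1)) < d\<^sup>2"
        "coeff_sqsum (p * F - monom 1 q * g) < d\<^sup>2"
        by (rule circle_transitivity)
      \<comment> \<open>The index is raised by \<open>q + l\<close>, so that the factors
        \<open>z^q\<close> and \<open>z^l\<close> lead back to \<open>b K\<close>.\<close>
      define B where "B = b (K + (q + l))"
      have B: "b K = (T ^^ q) ((T ^^ l) B)" "b K = (T ^^ l) ((T ^^ q) B)"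
      proof -
        have *: "b K = (T ^^ (q + l)) B" unfolding B_def by (simp only: b_pow)
        then show "b K = (T ^^ q) ((T ^^ l) B)" by (simp only: funpow_add o_apply)
        show "b K = (T ^^ l) ((T ^^ q) B)" unfolding * add.commute[of q] by (simp only: funpow_add o_apply)
      qed
      define X where "X = poly_op T F B - poly_op T f1 (b K)"
      define Y where "Y = poly_op T (p * F - monom 1 q * g) B"
      have small: "norm (poly_op T P B) < d" if "coeff_sqsum P < d\<^sup>2" for P
        using order_le_less_trans[OF b_bound that] unfolding B_def
        by (rule power2_less_imp_less) (use d in simp)
      have "X = poly_op T (F - monom 1 q * (monom 1 l * f1)) B"
        unfolding X_def B(1) po(7) by (simp only: po(3)[symmetric] po(4)[symmetric] mult_ac)
      then have X: "norm X < d" using small[OF F(1)] by simp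
      have Y: "norm Y < d" using small[OF F(2)] by (simp add: Y_def)
      define h where "h = k + (1 / of_real M) *\<^sub>C k' + poly_op T F B"
      have "norm (h - x) \<le> norm ((1 / of_real M) *\<^sub>C k') + norm X"
      proof -
        have "h - x = (1 / of_real M) *\<^sub>C k' + X" by (simp add: h_def x' X_def)
        then show ?thesis by (simp only: norm_triangle_ineq)
      qed
      also have "norm ((1 / complex_of_real M) *\<^sub>C k') = norm k' / M"
        using M by (simp add: norm_scaleC norm_divide)
      also have "\<dots> < e / 2" using M by (simp add: field_simps)
      finally have "norm (h - x) < e" using X d by linarith
      moreover have "h \<in> U v m"
      proof -
        define P where "P = smult (of_real M) (monom 1 j) + monom 1 l * p"
        have P: "poly_op T P y = of_real M *\<^sub>C (T ^^ j) y + (T ^^ l) (poly_op T p y)" for y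
          by (simp only: P_def po)
        have comm: "(T ^^ i) (poly_op T u y) = poly_op T u ((T ^^ i) y)" for i u y
          by (simp only: po(3)[symmetric] po(4)[symmetric] mult.commute)
        have "(T ^^ l) k = 0" "(T ^^ l) k' = 0"
          using pow_zero[OF x(2)] pow_zero[OF z(2)] by (auto simp: l_def)
        then have Pk: "poly_op T P k = 0" "poly_op T P k' = of_real M *\<^sub>C (T ^^ j) k'"
          using x(2) by (simp_all add: P comm poly_op_zero_right[OF lin])
        have "poly_op T P h = (T ^^ j) k' + (of_real M *\<^sub>C (T ^^ j) (poly_op T F B) + (T ^^ l) (poly_op T (p * F) B))"
          unfolding h_def po(5) po(6) Pk using M by (simp add: P po(3))
        also have "of_real M *\<^sub>C (T ^^ j) (poly_op T F B)
            = of_real M *\<^sub>C (T ^^ j) X + of_real M *\<^sub>C (T ^^ j) (poly_op T f1 (b K))"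
          by (simp add: X_def ell2.scale_right_distrib[symmetric] po(4)[symmetric] po(5)[symmetric])
        also have "(T ^^ l) (poly_op T (p * F) B) = (T ^^ l) Y + (T ^^ l) (poly_op T (monom 1 q * g) B)"
          by (simp add: Y_def po(4)[symmetric] po(5)[symmetric] po(7))
        also have "(T ^^ l) (poly_op T (monom 1 q * g) B) = poly_op T g (b K)"
          unfolding B(2) by (simp only: po(3)[symmetric] po(4)[symmetric] mult_ac)
        also have "poly_op T g (b K) = (T ^^ j) (poly_op T f2 (b K)) - of_real M *\<^sub>C (T ^^ j) (poly_op T f1 (b K))"
          by (simp add: g_def po)
        finally have "poly_op T P h - basis_vec v = of_real M *\<^sub>C (T ^^ j) X + (T ^^ l) Y"
          by (simp add: z')
        then have "norm (poly_op T P h - basis_vec v) \<le> norm (of_real M *\<^sub>C (T ^^ j) X) + norm ((T ^^ l) Y)"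
          by (simp only: norm_triangle_ineq)
        also have "\<dots> \<le> M * norm X + norm Y"
          using M contr_pow by (simp add: norm_scaleC add_mono mult_left_mono)
        also have "\<dots> \<le> M * d + d" using X Y M by (intro add_mono mult_left_mono) auto
        also have "\<dots> < r" using d(3) by (simp add: r_def field_simps)
        finally show ?thesis unfolding U_def r_def by blast
      qed
      ultimately show ?thesis by (auto simp: dist_norm)
    qed
    then have "D \<subseteq> closure (U v m)" by (auto simp: closure_approachable)
    then show ?thesis using D_dense by (metis closure_minimal closed_closure top.extremum_uniqueI)
  qed
  let ?G = "range (\<lambda>(v, m). U v m)"
  have "euclidean closure_of \<Inter>?G = topspace (euclidean :: 'v ell2 topology)"
  proof (rule Baire_category)
    have "countable (UNIV :: ('v \<times> nat) set)"
      using ctbl by (metis UNIV_Times_UNIV countable_SIGMA countableI_type)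
    then show "countable ?G" by (rule countable_image)
  qed (use completely_metrizable_space_euclidean U_open U_dense in auto)
  then have "closure (\<Inter>?G) = UNIV" by simp
  then have "\<Inter>?G \<noteq> {}" by (metis closure_empty UNIV_not_empty)
  then obtain h where h: "\<And>v m. h \<in> U v m" by auto
  have "closure (ell2.span (range (\<lambda>n. (T ^^ n) h))) = UNIV"
  proof (rule closure_ell2_subspace_UNIV)
    fix v
    show "basis_vec v \<in> closure (ell2.span (range (\<lambda>n. (T ^^ n) h)))"
      unfolding closure_approachable
    proof (intro allI impI)
      fix e :: real assume "0 < e"
      then obtain m where m: "1 / real (Suc m) < e" using nat_approx_posE by blast
      obtain P where "norm (poly_op T P h - basis_vec v) < 1 / real (Suc m)"
        using h[of v m] by (auto simp: U_def)
      then show "\<exists>y\<in>ell2.span (range (\<lambda>n. (T ^^ n) h)). dist y (basis_vec v) < e"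
        using m poly_op_in_span[of T P h] by (force simp: dist_norm)
    qed
  qed (auto intro: ell2.span_add ell2.span_scale)
  then show ?thesis unfolding cyclic_def by blast
qed


section \<open>The asymptotic limit of a shift on a directed tree\<close>

text \<open>For a finite partial sum \<open>s\<close>, testing \<open>S\<close> on the vector
  \<open>z\<close> with these coordinates gives \<open>s <= norm z * norm y\<close> with
  \<open>(norm z)^2 = s\<close>, so \<open>s <= (norm y)^2\<close>.\<close>

lemma hadjoint_coord_square_summable:
  assumes S: "bounded_operator S" and contr: "\<And>x. norm (S x) \<le> norm x"
  shows "square_summable (\<lambda>u. cinner y (S (basis_vec u)))"
  unfolding square_summable_def
proof (rule nonneg_bdd_above_summable_on)
  interpret S: Vector_Spaces.linear scaleC scaleC S using S by blast
  let ?c = "\<lambda>u. cinner y (S (basis_vec u))"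
  show "bdd_above (sum (\<lambda>u. (cmod (?c u))\<^sup>2) ` {F. F \<subseteq> UNIV \<and> finite F})"
  proof (rule bdd_aboveI2)
    fix F :: "'a set" assume "F \<in> {F. F \<subseteq> UNIV \<and> finite F}"
    then have F: "finite F" by simp
    define s where "s = (\<Sum>u\<in>F. (cmod (?c u))\<^sup>2)"
    define z where "z = (\<Sum>u\<in>F. ?c u *\<^sub>C basis_vec u)"
    have s0: "0 \<le> s" by (simp add: s_def sum_nonneg)
    have lin: "linear (\<lambda>x. cinner x t)" for t :: "'a ell2"
      using bounded_linear_cinner_left by (rule bounded_linear.linear)
    have coord_z: "coord z v = (if v \<in> F then ?c v else 0)" for v
      using F by (simp add: z_def coord_sum coord_basis_vec if_distrib[of "\<lambda>c. _ * c"] cong: if_cong)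
    have "cinner z t = (\<Sum>u\<in>F. ?c u * cnj (coord t u))" for t
      unfolding z_def by (simp add: linear_sum[OF lin] cinner_scaleC_left cinner_basis_left)
    then have "cinner z z = (\<Sum>u\<in>F. ?c u * cnj (coord z u))" .
    also have "\<dots> = of_real s"
      unfolding s_def of_real_sum complex_norm_square by (intro sum.cong) (simp_all add: coord_z)
    finally have zz: "(norm z)\<^sup>2 = s" by (simp add: power2_norm_eq_inner inner_ell2_def)
    have "cinner (S z) y = (\<Sum>u\<in>F. ?c u * cinner (S (basis_vec u)) y)"
      by (simp add: z_def S.sum S.scale linear_sum[OF lin] cinner_scaleC_left)
    also have "\<dots> = of_real s"
      unfolding s_def of_real_sum complex_norm_square
      by (simp add: cinner_commute[where x = y, symmetric])
    finally have "s \<le> norm (S z) * norm y"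
      using cmod_cinner_le[of "S z" y] s0 by simp
    also have "\<dots> \<le> norm z * norm y" by (intro mult_right_mono contr) auto
    finally have "s * s \<le> (norm z * norm y) * (norm z * norm y)"
      using s0 by (intro mult_mono) auto
    also have "\<dots> = s * (norm y)\<^sup>2" by (simp add: power2_eq_square flip: zz)
    finally show "sum (\<lambda>u. (cmod (?c u))\<^sup>2) F \<le> (norm y)\<^sup>2"
      using s0 by (cases "s = 0") (auto simp: s_def[symmetric])
  qed
qed auto

text \<open>\<open>hadjoint\<close> is a definite description, so a map with the adjoint identity is
  built from its coordinates; the identity extends from basis vectors by continuity.\<close>

lemma cinner_hadjoint:
  assumes S: "bounded_operator S" and contr: "\<And>x. norm (S x) \<le> norm x"
  shows "cinner (S x) y = cinner x (hadjoint S y)"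
proof -
  define T where "T y = Abs_ell2 (\<lambda>u. cinner y (S (basis_vec u)))" for y
  have coord_T: "coord (T y) u = cinner y (S (basis_vec u))" for y u
    unfolding T_def by (subst Abs_ell2_inverse) (auto intro: hadjoint_coord_square_summable[OF assms])
  interpret S: Vector_Spaces.linear scaleC scaleC S using S by blast
  have adj: "cinner (S x) y = cinner x (T y)" for x y
  proof -
    have "bounded_linear (\<lambda>x. cinner (S x) y)"
      using S by (intro bounded_linear_compose[OF bounded_linear_cinner_left, unfolded o_def]) blast
    from has_sum_bounded_linear[OF this has_sum_basis[of x]]
    have "((\<lambda>v. coord x v * cnj (coord (T y) v)) has_sum cinner (S x) y) UNIV"
      by (simp add: o_def S.scale cinner_scaleC_left coord_T cinner_commute[where x = y, symmetric])
    then show ?thesis unfolding cinner_def[of x] by (simp add: infsumI)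
  qed
  show ?thesis using adj hadjoint_eqI[of S T] by simp
qed

text \<open>The operators \<open>T^k S^k\<close> are positive and decreasing; the differences of
  their values at \<open>x\<close> are controlled by those of the convergent sequence
  \<open>(norm ((S ^^ k) x))^2\<close>.\<close>

lemma asymptotic_limit_convergent:
  fixes S T :: "'a::{real_inner, complete_space} \<Rightarrow> 'a"
  assumes lin: "linear S" and adj: "\<And>x y. S x \<bullet> y = x \<bullet> T y"
    and contr: "\<And>x. norm (S x) \<le> norm x"
  shows "convergent (\<lambda>k. (T ^^ k) ((S ^^ k) x))"
proof -
  have adj_pow: "(S ^^ k) x \<bullet> y = x \<bullet> (T ^^ k) y" for k x y
    by (induction k arbitrary: y) (simp_all add: adj, simp add: funpow_swap1)
  have lin_pow: "linear (S ^^ k)" for k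
    by (induction k) (auto simp: linear_iff intro!: linearI simp: linear_add[OF lin] linear_scale[OF lin])
  have mono: "norm ((S ^^ n) x) \<le> norm ((S ^^ m) x)" if "m \<le> n" for m n x
    using that by (induction rule: dec_induct) (auto intro: order_trans[OF contr])
  define A where "A k x = (T ^^ k) ((S ^^ k) x)" for k x
  have A: "A k x \<bullet> y = (S ^^ k) x \<bullet> (S ^^ k) y" for k x y
    unfolding A_def by (metis adj_pow inner_commute)
  have key: "(norm (A m x - A n x))\<^sup>2 \<le> (norm ((S ^^ m) x))\<^sup>2 - (norm ((S ^^ n) x))\<^sup>2" if "m \<le> n" for m n x
  proof -
    \<comment> \<open>Positivity of \<open>A m - A n\<close> is applied to \<open>x - (A m - A n) x\<close>.\<close>
    define y where "y = A m x - A n x"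
    have expand: "(norm ((S ^^ k) (x - y)))\<^sup>2 = (norm ((S ^^ k) x))\<^sup>2 - 2 * (A k x \<bullet> y) + (norm ((S ^^ k) y))\<^sup>2" for k
      unfolding A
      by (simp add: linear_diff[OF lin_pow] power2_norm_eq_inner inner_diff_left inner_diff_right inner_commute)
    have "(norm ((S ^^ n) (x - y)))\<^sup>2 \<le> (norm ((S ^^ m) (x - y)))\<^sup>2"
      by (intro power_mono mono that) auto
    moreover have "A m x \<bullet> y - A n x \<bullet> y = (norm y)\<^sup>2"
      by (simp add: y_def power2_norm_eq_inner inner_diff_left)
    moreover have "(norm ((S ^^ m) y))\<^sup>2 \<le> (norm y)\<^sup>2"
      using mono[of 0 m y] by (intro power_mono) auto
    moreover have "0 \<le> (norm ((S ^^ n) y))\<^sup>2" by simp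
    ultimately show ?thesis unfolding expand y_def[symmetric] by linarith
  qed
  define q where "q k = (norm ((S ^^ k) x))\<^sup>2" for k
  have "decseq q" unfolding decseq_def q_def by (intro allI impI power_mono mono) auto
  then obtain l where "q \<longlonglongrightarrow> l" by (rule decseq_convergent[of q 0]) (simp_all add: q_def)
  then have "Cauchy q" by (rule LIMSEQ_imp_Cauchy)
  have "Cauchy (\<lambda>k. A k x)"
  proof (rule metric_CauchyI)
    fix e :: real assume e: "0 < e"
    then obtain M where M: "\<And>m n. m \<ge> M \<Longrightarrow> n \<ge> M \<Longrightarrow> dist (q m) (q n) < e\<^sup>2"
      using metric_CauchyD[OF \<open>Cauchy q\<close>, of "e\<^sup>2"] by auto
    have le: "dist (A m x) (A n x) < e" if "M \<le> m" "m \<le> n" for m n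
    proof -
      have "(norm (A m x - A n x))\<^sup>2 < e\<^sup>2"
        using key[OF that(2), of x] M[of m n] that by (auto simp: q_def dist_real_def)
      then have "norm (A m x - A n x) < e" by (rule power2_less_imp_less) (use e in simp)
      then show ?thesis by (simp add: dist_norm)
    qed
    have "dist (A m x) (A n x) < e" if "M \<le> m" "M \<le> n" for m n
      using le[of m n] le[of n m] that by (cases "m \<le> n") (auto simp: dist_commute)
    then show "\<exists>M. \<forall>m\<ge>M. \<forall>n\<ge>M. dist (A m x) (A n x) < e" by blast
  qed
  then show ?thesis unfolding A_def by (rule Cauchy_convergent)
qed

lemma countable_support: "countable {v. coord x v \<noteq> 0}"
proof -
  have "countable {v \<in> UNIV. (cmod (coord x v))\<^sup>2 \<noteq> 0}"
    using square_summable_coord[of x] unfolding square_summable_def by (rule summable_countable_real)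
  then show ?thesis by simp
qed

section \<open>Generations in the tree and supports under the shift\<close>

locale C1_tree_shift =
  fixes E :: "('v \<times> 'v) set" and lam :: "'v \<Rightarrow> real" and S :: "'v ell2 \<Rightarrow> 'v ell2"
  assumes tree: "directed_tree E"
    and lam_pos: "\<And>u v. (u, v) \<in> E \<Longrightarrow> 0 < lam v"
    and shift: "weighted_shift E lam S"
    and C1: "class_C1 S"
begin

lemma bounded_operator_S: "bounded_operator S"
  using C1 by (simp add: class_C1_def contraction_def)

lemma norm_S_le: "norm (S x) \<le> norm x"
proof -
  have "norm (S x) \<le> onorm S * norm x"
    using bounded_operator_S by (intro onorm) blast
  also have "\<dots> \<le> 1 * norm x"
    using C1 by (intro mult_right_mono) (auto simp: class_C1_def contraction_def)
  finally show ?thesis by simp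
qed

lemma norm_S_pow_le: "norm ((S ^^ k) x) \<le> norm x"
  by (induction k) (auto intro: order_trans[OF norm_S_le])

sublocale S: Vector_Spaces.linear scaleC scaleC S
  using bounded_operator_S by blast

lemma C1_nonzero: "x \<noteq> 0 \<Longrightarrow> \<not> (\<lambda>n. norm ((S ^^ n) x)) \<longlonglongrightarrow> 0"
  using C1 by (auto simp: class_C1_def)

lemma S_nonzero:
  assumes "x \<noteq> 0"
  shows "S x \<noteq> 0"
proof
  assume "S x = 0"
  then have "norm ((S ^^ Suc n) x) = 0" for n
    by (induction n) (simp_all add: S.zero)
  then have "(\<lambda>n. norm ((S ^^ Suc n) x)) \<longlonglongrightarrow> 0" by simp
  then show False using C1_nonzero[OF assms] LIMSEQ_imp_Suc[of "\<lambda>n. norm ((S ^^ n) x)" 0] by blast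
qed

lemma unique_parent: "(u, v) \<in> E \<Longrightarrow> (u', v) \<in> E \<Longrightarrow> u = u'"
  using tree unfolding directed_tree_def by blast

lemma unique_ancestor: "(u, v) \<in> E ^^ k \<Longrightarrow> (u', v) \<in> E ^^ k \<Longrightarrow> u = u'"
  by (induction k arbitrary: v) (auto dest: unique_parent elim!: relcompEpair)

text \<open>Two different depths would, by uniqueness of ancestors, produce a directed circuit
  through \<open>w\<close>.\<close>

lemma unique_depth:
  assumes "(w, v) \<in> E ^^ j" "(w, v) \<in> E ^^ k"
  shows "j = k"
proof -
  have False if jk: "j < k" and j: "(w, v) \<in> E ^^ j" and k: "(w, v) \<in> E ^^ k" for j k
  proof -
    have "(w, v) \<in> E ^^ (k - j) O E ^^ j"
      using jk k by (simp flip: relpow_add)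
    then obtain y where y: "(w, y) \<in> E ^^ (k - j)" "(y, v) \<in> E ^^ j" by blast
    then have "(w, w) \<in> E ^^ (k - j)" using unique_ancestor j by blast
    then have "(w, w) \<in> E\<^sup>+" using jk by (auto simp: trancl_power intro!: exI[of _ "k - j"])
    then show False using tree by (simp add: directed_tree_def acyclic_def)
  qed
  then show ?thesis using assms by (metis nat_neq_iff)
qed

text \<open>Induction along an undirected path. On a step up from \<open>y\<close> to its parent
  \<open>z\<close>, either \<open>y\<close> was the common ancestor and \<open>z\<close> replaces
  it, or the path down to \<open>y\<close> already passes through \<open>z\<close>.\<close>

lemma common_ancestor: "\<exists>u m n. (u, v) \<in> E ^^ m \<and> (u, w) \<in> E ^^ n"
proof -
  have "(w, v) \<in> (E \<union> E\<inverse>)\<^sup>*" using tree by (simp add: directed_tree_def)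
  then have "\<exists>u. (u, v) \<in> E\<^sup>* \<and> (u, w) \<in> E\<^sup>*"
  proof induction
    case base
    then show ?case by blast
  next
    case (step y z)
    then obtain u where u: "(u, y) \<in> E\<^sup>*" "(u, w) \<in> E\<^sup>*" by blast
    show ?case
    proof (cases "(y, z) \<in> E")
      case True
      then show ?thesis using u by (meson rtrancl.rtrancl_into_rtrancl)
    next
      case False
      then have zy: "(z, y) \<in> E" using step by blast
      from u(1) show ?thesis
      proof (cases rule: rtranclE)
        case base
        then show ?thesis using zy u(2) by (meson converse_rtrancl_into_rtrancl rtrancl.rtrancl_refl)
      next
        case (step y')
        then show ?thesis using unique_parent[OF zy] u(2) by blast
      qed
    qed
  qed
  then show ?thesis by (auto simp: rtrancl_power)
qed

lemma coord_S_basis: "coord (S (basis_vec u)) v = (if (u, v) \<in> E then of_real (lam v) else 0)"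
proof -
  have "((\<lambda>w. lam w *\<^sub>R basis_vec w) has_sum S (basis_vec u)) (Chi E u)"
    using shift by (simp add: weighted_shift_def)
  from has_sum_bounded_linear[OF bounded_linear_coord this, of v]
  have "coord (S (basis_vec u)) v = (\<Sum>\<^sub>\<infinity>w\<in>Chi E u. coord (lam w *\<^sub>R basis_vec w) v)"
    by (simp add: o_def infsumI)
  also have "\<dots> = (\<Sum>\<^sub>\<infinity>w\<in>Chi E u \<inter> {v}. coord (lam w *\<^sub>R basis_vec w) v)"
    by (rule infsum_cong_neutral) (auto simp: scaleR_eq_scaleC coord_basis_vec)
  also have "\<dots> = (if (u, v) \<in> E then of_real (lam v) else 0)"
    by (auto simp: Chi_def scaleR_eq_scaleC coord_basis_vec)
  finally show ?thesis .
qed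

lemma coord_S_support:
  assumes "coord (S x) v \<noteq> 0"
  shows "\<exists>u. (u, v) \<in> E \<and> coord x u \<noteq> 0"
proof (rule ccontr)
  assume none: "\<not> ?thesis"
  have "bounded_linear (\<lambda>x. coord (S x) v)"
    using bounded_operator_S
    by (intro bounded_linear_compose[OF bounded_linear_coord, unfolded o_def]) blast
  from has_sum_bounded_linear[OF this has_sum_basis[of x]]
  have "coord (S x) v = (\<Sum>\<^sub>\<infinity>u. coord x u * coord (S (basis_vec u)) v)"
    by (simp add: o_def S.scale infsumI)
  also have "\<dots> = 0"
    using none by (intro infsum_0) (auto simp: coord_S_basis)
  finally show False using assms by simp
qed

lemma coord_S_pow_support:
  "coord ((S ^^ k) x) v \<noteq> 0 \<Longrightarrow> \<exists>u. (u, v) \<in> E ^^ k \<and> coord x u \<noteq> 0"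
proof (induction k arbitrary: v)
  case (Suc k)
  then obtain y where "(y, v) \<in> E" "coord ((S ^^ k) x) y \<noteq> 0"
    using coord_S_support[of "(S ^^ k) x" v] by auto
  with Suc.IH[of y] show ?case by auto
qed auto

lemma coord_S_pow_basis_support:
  "coord ((S ^^ k) (basis_vec w)) v \<noteq> 0 \<Longrightarrow> (w, v) \<in> E ^^ k"
  using coord_S_pow_support[of k "basis_vec w" v] by (auto simp: coord_basis_vec split: if_splits)

text \<open>The basis vector of a leaf would lie in the kernel of \<open>S\<close>, against
  \<open>C1\<close>.\<close>

lemma Chi_nonempty: "\<exists>v. (u, v) \<in> E"
proof (rule ccontr)
  assume "\<not> ?thesis"
  then have "S (basis_vec u) = 0" by (intro ell2_eqI) (simp add: coord_S_basis)
  moreover have "basis_vec u \<noteq> 0" using norm_basis_vec[of u] by force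
  ultimately show False using S_nonzero by blast
qed

text \<open>As weights are positive, the children of \<open>u\<close> lie in the countable support
  of \<open>S (basis_vec u)\<close>; every vertex is joined to a fixed one by a finite undirected
  path. Countability is what the Baire argument requires.\<close>

lemma countable_vertices: "countable (UNIV :: 'v set)"
proof -
  have Chi: "countable (Chi E u)" for u
  proof (rule countable_subset)
    show "Chi E u \<subseteq> {v. coord (S (basis_vec u)) v \<noteq> 0}"
      using lam_pos by (force simp: Chi_def coord_S_basis)
  qed (rule countable_support)
  have parents: "countable {u. (u, v) \<in> E}" for v
  proof (cases "\<exists>u. (u, v) \<in> E")
    case True
    then obtain u where "(u, v) \<in> E" by blast
    then have "{u. (u, v) \<in> E} = {u}" using unique_parent by blast
    then show ?thesis by simp
  qed simp
  have "countable (((E \<union> E\<inverse>) ^^ n) `` {w})" for n w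
  proof (induction n)
    case (Suc n)
    have "((E \<union> E\<inverse>) ^^ Suc n) `` {w} = (\<Union>v\<in>((E \<union> E\<inverse>) ^^ n) `` {w}. Chi E v \<union> {u. (u, v) \<in> E})"
      by (auto simp: Chi_def)
    then show ?case using Suc Chi parents by simp
  qed simp
  then have "countable (\<Union>n. ((E \<union> E\<inverse>) ^^ n) `` {w})" for w by blast
  moreover have "UNIV = (\<Union>n. ((E \<union> E\<inverse>) ^^ n) `` {w})" for w
    using tree by (force simp: directed_tree_def rtrancl_power)
  ultimately show ?thesis by metis
qed

section \<open>The adjoint shift and its asymptotic limit\<close>

abbreviation "T \<equiv> hadjoint S"

lemma adjoint: "cinner (S x) y = cinner x (T y)"
  by (rule cinner_hadjoint[OF bounded_operator_S norm_S_le])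

lemma adjoint_inner: "S x \<bullet> y = x \<bullet> T y"
  by (simp add: inner_ell2_def adjoint)

lemma coord_T: "coord (T y) u = cinner y (S (basis_vec u))"
  by (metis adjoint cinner_basis_right cinner_commute)

lemma norm_T_le: "norm (T y) \<le> norm y"
proof -
  have "norm (T y) * norm (T y) = S (T y) \<bullet> y"
    by (simp add: adjoint_inner power2_norm_eq_inner flip: power2_eq_square)
  also have "\<dots> \<le> norm (S (T y)) * norm y" by (rule norm_cauchy_schwarz)
  also have "\<dots> \<le> norm (T y) * norm y" by (intro mult_right_mono norm_S_le) auto
  finally show ?thesis by (cases "T y = 0") auto
qed

lemma norm_T_pow_le: "norm ((T ^^ k) x) \<le> norm x"
  by (induction k) (auto intro: order_trans[OF norm_T_le])

lemma T_linear: "Vector_Spaces.linear scaleC scaleC T"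
proof (unfold_locales)
  show "T (x + y) = T x + T y" for x y
    by (rule ell2_eqI) (simp add: coord_T coord_add cinner_add_left)
  show "T (c *\<^sub>C x) = c *\<^sub>C T x" for c x
    by (rule ell2_eqI) (simp add: coord_T cinner_scaleC_left)
qed

sublocale T: Vector_Spaces.linear scaleC scaleC T by (rule T_linear)

lemma bounded_operator_T: "bounded_operator T"
proof
  show "bounded_linear T"
  proof (rule bounded_linear.intro)
    show "linear T" by (rule linearI) (simp_all add: T.add T.scale scaleR_eq_scaleC)
    show "bounded_linear_axioms T" by unfold_locales (metis norm_T_le mult_1_right)
  qed
qed (rule T_linear)

lemma T_basis:
  assumes "(u, v) \<in> E"
  shows "T (basis_vec v) = of_real (lam v) *\<^sub>C basis_vec u"
proof (rule ell2_eqI)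
  fix x
  have "(x, v) \<in> E \<longleftrightarrow> x = u" using assms unique_parent by blast
  then show "coord (T (basis_vec v)) x = coord (of_real (lam v) *\<^sub>C basis_vec u) x"
    by (simp add: coord_T cinner_basis_left coord_S_basis coord_basis_vec)
qed

lemma T_pow_basis:
  "(u, v) \<in> E ^^ m \<Longrightarrow> \<exists>c. c \<noteq> 0 \<and> (T ^^ m) (basis_vec v) = c *\<^sub>C basis_vec u"
proof (induction m arbitrary: v)
  case 0
  then show ?case by (auto intro: exI[of _ 1])
next
  case (Suc m)
  then obtain y where y: "(u, y) \<in> E ^^ m" "(y, v) \<in> E" by auto
  obtain c where c: "c \<noteq> 0" "(T ^^ m) (basis_vec y) = c *\<^sub>C basis_vec u" using Suc.IH[OF y(1)] by blast
  have "(T ^^ Suc m) (basis_vec v) = (T ^^ m) (of_real (lam v) *\<^sub>C basis_vec y)"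
    by (simp add: T_basis[OF y(2)] funpow_Suc_right del: funpow.simps)
  also have "\<dots> = of_real (lam v) *\<^sub>C c *\<^sub>C basis_vec u"
    using poly_op_scale_right[OF T_linear, of "monom 1 m"] c(2) by (simp add: poly_op_monom[OF T_linear])
  finally show ?case using lam_pos[OF y(2)] c(1) by (intro exI[of _ "of_real (lam v) * c"]) simp
qed

lemma T_surj_basis: "\<exists>w c. T (c *\<^sub>C basis_vec w) = basis_vec v"
proof -
  obtain w where w: "(v, w) \<in> E" using Chi_nonempty by blast
  have "T ((1 / of_real (lam w)) *\<^sub>C basis_vec w) = basis_vec v"
    using lam_pos[OF w] by (simp add: T.scale T_basis[OF w])
  then show ?thesis by blast
qed

definition A :: "'v ell2 \<Rightarrow> 'v ell2" where
  "A x = lim (\<lambda>k. (T ^^ k) ((S ^^ k) x))"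

lemma A_lim: "(\<lambda>k. (T ^^ k) ((S ^^ k) x)) \<longlonglongrightarrow> A x"
proof -
  have "linear S" using bounded_operator_S by (blast intro: bounded_linear.linear)
  from asymptotic_limit_convergent[OF this adjoint_inner norm_S_le]
  show ?thesis unfolding A_def by (simp add: convergent_LIMSEQ_iff)
qed

lemma S_pow_add: "(S ^^ k) (x + y) = (S ^^ k) x + (S ^^ k) y"
  by (induction k) (simp_all add: S.add)

lemma T_pow_add: "(T ^^ k) (x + y) = (T ^^ k) x + (T ^^ k) y"
  by (induction k) (simp_all add: T.add)

lemma S_pow_scale: "(S ^^ k) (c *\<^sub>C x) = c *\<^sub>C (S ^^ k) x"
  by (induction k) (simp_all add: S.scale)

lemma T_pow_scale: "(T ^^ k) (c *\<^sub>C x) = c *\<^sub>C (T ^^ k) x"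
  by (induction k) (simp_all add: T.scale)

lemma A_linear: "Vector_Spaces.linear scaleC scaleC A"
proof (unfold_locales)
  show "A (x + y) = A x + A y" for x y
    using tendsto_add[OF A_lim[of x] A_lim[of y]] A_lim[of "x + y"]
    by (simp add: S_pow_add T_pow_add LIMSEQ_unique)
  show "A (c *\<^sub>C x) = c *\<^sub>C A x" for c x
    using bounded_linear.tendsto[OF bounded_linear_scaleC A_lim[of x], of c] A_lim[of "c *\<^sub>C x"]
    by (simp add: S_pow_scale T_pow_scale LIMSEQ_unique)
qed

sublocale A: Vector_Spaces.linear scaleC scaleC A by (rule A_linear)

lemma norm_A_le: "norm (A x) \<le> norm x"
proof (rule tendsto_upperbound)
  show "(\<lambda>k. norm ((T ^^ k) ((S ^^ k) x))) \<longlonglongrightarrow> norm (A x)"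
    by (intro tendsto_norm A_lim)
  show "\<forall>\<^sub>F k in sequentially. norm ((T ^^ k) ((S ^^ k) x)) \<le> norm x"
    by (intro always_eventually allI order_trans[OF norm_T_pow_le norm_S_pow_le])
qed simp

text \<open>The sequence defining \<open>A x\<close>, shifted by one index, is \<open>T\<close>
  applied to the sequence defining \<open>A (S x)\<close>.\<close>

lemma T_A_S: "T (A (S x)) = A x"
proof (rule LIMSEQ_unique)
  have "(\<lambda>k. T ((T ^^ k) ((S ^^ k) (S x)))) \<longlonglongrightarrow> T (A (S x))"
    using bounded_operator_T bounded_linear.tendsto[OF _ A_lim[of "S x"], of T] by blast
  then show "(\<lambda>k. (T ^^ Suc k) ((S ^^ Suc k) x)) \<longlonglongrightarrow> T (A (S x))"
    by (simp add: funpow_swap1)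
  show "(\<lambda>k. (T ^^ Suc k) ((S ^^ Suc k) x)) \<longlonglongrightarrow> A x"
    using A_lim by (rule LIMSEQ_Suc)
qed

lemma T_pow_A_S_pow: "(T ^^ n) (A ((S ^^ n) x)) = A x"
proof (induction n)
  case (Suc n)
  have "(T ^^ Suc n) (A ((S ^^ Suc n) x)) = (T ^^ n) (T (A (S ((S ^^ n) x))))"
    by (simp add: funpow_swap1)
  then show ?case by (simp only: T_A_S Suc)
qed simp

lemma adjoint_pow: "cinner ((S ^^ k) x) y = cinner x ((T ^^ k) y)"
  by (induction k arbitrary: y) (simp_all add: adjoint, simp add: funpow_swap1)

text \<open>Different vertices have disjoint sets of descendants in generation \<open>k\<close>, so
  \<open>T^k S^k\<close> is diagonal. The diagonal entry of the limit is that of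
  \<open>(norm ((S ^^ k) (basis_vec w)))^2\<close>, which \<open>C1\<close> prevents from being
  0.\<close>

lemma A_basis: "\<exists>a. a \<noteq> 0 \<and> A (basis_vec w) = a *\<^sub>C basis_vec w"
proof -
  let ?e = "basis_vec w"
  have zero: "coord (A ?e) v = 0" if "v \<noteq> w" for v
  proof (rule LIMSEQ_unique)
    show "(\<lambda>k. coord ((T ^^ k) ((S ^^ k) ?e)) v) \<longlonglongrightarrow> coord (A ?e) v"
      by (intro bounded_linear.tendsto[OF bounded_linear_coord] A_lim)
    have "coord ((T ^^ k) ((S ^^ k) ?e)) v = 0" for k
    proof -
      have "cinner ((S ^^ k) (basis_vec v)) ((S ^^ k) ?e) = 0"
        using that by (intro cinner_eq_0_if_disjoint_support) (metis coord_S_pow_basis_support unique_ancestor)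
      then have "cinner (basis_vec v) ((T ^^ k) ((S ^^ k) ?e)) = 0" by (simp add: adjoint_pow)
      then show ?thesis by (simp add: cinner_basis_left)
    qed
    then show "(\<lambda>k. coord ((T ^^ k) ((S ^^ k) ?e)) v) \<longlonglongrightarrow> 0" by simp
  qed
  have eq: "A ?e = coord (A ?e) w *\<^sub>C ?e"
    by (rule ell2_eqI) (use zero in \<open>auto simp: coord_basis_vec\<close>)
  have "coord (A ?e) w \<noteq> 0"
  proof
    assume "coord (A ?e) w = 0"
    then have "A ?e = 0" using eq by simp
    then have "(\<lambda>k. ?e \<bullet> (T ^^ k) ((S ^^ k) ?e)) \<longlonglongrightarrow> ?e \<bullet> 0"
      using A_lim[of ?e] by (intro tendsto_intros) simp
    moreover have "?e \<bullet> (T ^^ k) ((S ^^ k) ?e) = (norm ((S ^^ k) ?e))\<^sup>2" for k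
      by (simp add: power2_norm_eq_inner inner_ell2_def flip: adjoint_pow)
    ultimately have "(\<lambda>k. sqrt ((norm ((S ^^ k) ?e))\<^sup>2)) \<longlonglongrightarrow> sqrt 0"
      by (intro tendsto_real_sqrt) simp
    moreover have "?e \<noteq> 0" using norm_basis_vec[of w] by force
    ultimately show False using C1_nonzero by simp
  qed
  with eq show ?thesis by blast
qed

lemma norm_sum_S_pow_basis_le:
  assumes "finite I" "inj_on p I"
  shows "(norm (\<Sum>i\<in>I. c i *\<^sub>C (S ^^ p i) (basis_vec w)))\<^sup>2 \<le> (\<Sum>i\<in>I. (cmod (c i))\<^sup>2)"
proof -
  have "cinner (c i *\<^sub>C (S ^^ p i) (basis_vec w)) (c j *\<^sub>C (S ^^ p j) (basis_vec w)) = 0"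
    if "i \<in> I" "j \<in> I" "i \<noteq> j" for i j
  proof (rule cinner_eq_0_if_disjoint_support)
    have "p i \<noteq> p j" using that assms(2) by (auto dest: inj_onD)
    then show "coord (c i *\<^sub>C (S ^^ p i) (basis_vec w)) v = 0 \<or> coord (c j *\<^sub>C (S ^^ p j) (basis_vec w)) v = 0" for v
      using coord_S_pow_basis_support unique_depth by (metis coord_scaleC mult_zero_right)
  qed
  then have "pairwise (\<lambda>i j. orthogonal (c i *\<^sub>C (S ^^ p i) (basis_vec w)) (c j *\<^sub>C (S ^^ p j) (basis_vec w))) I"
    by (simp add: pairwise_def orthogonal_def inner_ell2_def)
  then have "(norm (\<Sum>i\<in>I. c i *\<^sub>C (S ^^ p i) (basis_vec w)))\<^sup>2
      = (\<Sum>i\<in>I. (norm (c i *\<^sub>C (S ^^ p i) (basis_vec w)))\<^sup>2)"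
    by (rule norm_sum_Pythagorean[OF assms(1)])
  also have "\<dots> \<le> (\<Sum>i\<in>I. (cmod (c i))\<^sup>2)"
    using norm_S_pow_le[of _ "basis_vec w"]
    by (intro sum_mono power_mono) (simp_all add: norm_scaleC norm_basis_vec mult_left_le)
  finally show ?thesis .
qed

text \<open>Reversing the coefficients turns a polynomial in the adjoint at \<open>A x\<close> into a polynomial in \<open>S\<close>
  at \<open>x\<close>, and the vectors \<open>S\<^sup>i e\<^sub>w\<close> are orthogonal because they live on different generations.\<close>

lemma backward_orbit_bound:
  "(norm (poly_op T P (A ((S ^^ n) (basis_vec w)))))\<^sup>2 \<le> coeff_sqsum P"
proof -
  define d where "d = degree P"
  \<comment> \<open>By \<open>T A S = A\<close>, every term is brought to the common power
    \<open>T^d\<close>.\<close>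
  have "(T ^^ i) (A ((S ^^ n) (basis_vec w))) = (T ^^ d) (A ((S ^^ (d - i + n)) (basis_vec w)))" if "i \<le> d" for i
  proof -
    have "(T ^^ d) y = (T ^^ i) ((T ^^ (d - i)) y)" for y
      using that by (metis funpow_add le_add_diff_inverse o_apply)
    moreover have "(S ^^ (d - i + n)) y = (S ^^ (d - i)) ((S ^^ n) y)" for y
      by (simp add: funpow_add)
    ultimately show ?thesis by (simp add: T_pow_A_S_pow)
  qed
  then have "poly_op T P (A ((S ^^ n) (basis_vec w)))
      = (\<Sum>i\<le>d. coeff P i *\<^sub>C (T ^^ d) (A ((S ^^ (d - i + n)) (basis_vec w))))"
    by (simp add: poly_op_def d_def)
  also have "\<dots> = (T ^^ d) (A (\<Sum>i\<le>d. coeff P i *\<^sub>C (S ^^ (d - i + n)) (basis_vec w)))"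
  proof -
    have "(T ^^ k) (sum f I) = (\<Sum>i\<in>I. (T ^^ k) (f i))" for k f and I :: "nat set"
      by (induction k) (simp_all add: T.sum)
    then show ?thesis by (simp add: A.sum A.scale T_pow_scale)
  qed
  finally have "norm (poly_op T P (A ((S ^^ n) (basis_vec w))))
      \<le> norm (\<Sum>i\<le>d. coeff P i *\<^sub>C (S ^^ (d - i + n)) (basis_vec w))"
    by (simp only: order_trans[OF norm_T_pow_le norm_A_le])
  then have "(norm (poly_op T P (A ((S ^^ n) (basis_vec w)))))\<^sup>2
      \<le> (norm (\<Sum>i\<le>d. coeff P i *\<^sub>C (S ^^ (d - i + n)) (basis_vec w)))\<^sup>2"
    by (intro power_mono) auto
  also have "\<dots> \<le> coeff_sqsum P"
    unfolding coeff_sqsum_def d_def by (intro norm_sum_S_pow_basis_le) (auto simp: inj_on_def)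
  finally show ?thesis .
qed

text \<open>Powers of \<open>T\<close> send \<open>basis_vec v\<close> and
  \<open>basis_vec w\<close> to multiples of the basis vector of a common ancestor, so a multiple of
  an orbit vector cancels \<open>basis_vec v\<close> after \<open>m\<close> steps.\<close>

lemma basis_decomposition:
  "\<exists>n f k j. basis_vec v = k + poly_op T f (A ((S ^^ n) (basis_vec w))) \<and> (T ^^ j) k = 0"
proof -
  obtain u m n where u: "(u, v) \<in> E ^^ m" "(u, w) \<in> E ^^ n" using common_ancestor by blast
  obtain c where c: "(T ^^ m) (basis_vec v) = c *\<^sub>C basis_vec u" using T_pow_basis[OF u(1)] by blast
  obtain d where d: "d \<noteq> 0" "(T ^^ n) (basis_vec w) = d *\<^sub>C basis_vec u" using T_pow_basis[OF u(2)] by blast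
  obtain a where a: "a \<noteq> 0" "A (basis_vec w) = a *\<^sub>C basis_vec w" using A_basis by blast
  let ?b = "A ((S ^^ m) (basis_vec w))"
  \<comment> \<open>\<open>T^m\<close> maps \<open>?b\<close> to \<open>a\<close> times
    \<open>basis_vec w\<close>, and \<open>T^n\<close> adds the factor \<open>d\<close>; the
    quotient leaves exactly \<open>c\<close>.\<close>
  define f where "f = smult (c / (a * d)) (monom 1 n)"
  have "(T ^^ m) (poly_op T f ?b) = poly_op T f ((T ^^ m) ?b)"
    by (simp only: poly_op_mult[OF T_linear, symmetric] poly_op_monom[OF T_linear, symmetric] mult.commute)
  also have "\<dots> = c *\<^sub>C basis_vec u"
    using a d by (simp add: T_pow_A_S_pow f_def poly_op_smult[OF T_linear] poly_op_monom[OF T_linear] T_pow_scale)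
  finally have "(T ^^ m) (basis_vec v - poly_op T f ?b) = 0"
    using T_pow_add[of m "basis_vec v - poly_op T f ?b" "poly_op T f ?b"] c by simp
  then show ?thesis by (metis diff_add_cancel)
qed

theorem cyclic_adjoint: "cyclic T"
proof (rule cyclic_of_backward_orbit)
  \<comment> \<open>\<open>undefined\<close> serves as an arbitrary vertex from which the orbit
    starts.\<close>
  show "T (A ((S ^^ Suc n) (basis_vec undefined))) = A ((S ^^ n) (basis_vec undefined))" for n
    by (simp add: T_A_S)
qed (rule bounded_operator_T norm_T_le countable_vertices backward_orbit_bound
    basis_decomposition T_surj_basis)+

end

theorem theorem7p3:
  fixes E :: "('v \<times> 'v) set"
    and lam :: "'v \<Rightarrow> real"
    and S :: "'v ell2 \<Rightarrow> 'v ell2"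
  assumes "directed_tree E"
    and "admissible_weights E lam"
    and "weighted_shift E lam S"
    and "contraction S"
  shows "((\<exists>r. is_root E r) \<and> class_C1 S \<longrightarrow> cyclic (hadjoint S)) \<and>
         ((\<nexists>r. is_root E r) \<and> Br E < \<infinity> \<and> class_C1 S \<longrightarrow> cyclic (hadjoint S))"
proof -
  have "cyclic (hadjoint S)" if "class_C1 S"
  proof -
    have "0 < lam v" if "(u, v) \<in> E" for u v
      using assms(2) that by (auto simp: admissible_weights_def nonroots_def is_root_def)
    then interpret C1_tree_shift E lam S
      using assms that by unfold_locales
    show ?thesis by (rule cyclic_adjoint)
  qed
  then show ?thesis by blast
qed

end
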